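(* Let $G$ be a Garside group with Garside element $\Delta$, let $r$ be a natural number, let $p,q\in\mathbb{Z}^r$ with $p\le q$, and let $a\in G^r$ with $a\in[p,q]$. Let $i\in\{1,\dotsc,r\}$ and let $(\tilde p,\tilde q)\in\{(p+e_i,q),(p,q-e_i)\}$ be a pair with $a^G\cap[\tilde p,\tilde q]\ne\emptyset$. Let $\operatorname{sl}$ denote simultaneous cyclic sliding with respect to the (fixed) target interval $[\tilde p,\tilde q]$. Then $$\operatorname{sl}^{\|\Delta\|-1}(a)=\underbrace{\operatorname{sl}(\operatorname{sl}(\cdots\operatorname{sl}(a)))}_{\|\Delta\|-1\text{ times}}\in[\tilde p,\tilde q].$$
   Context: Garside groups. A monoid $M$ is Noetherian if for each $a\in M$ there is $n\in\mathbb N$ such that $a$ is not a product of more than $n$ nonidentity elements. In a monoid, $a$ is a left divisor of $b$ ($a\preceq b$) if $b\in aM$, and a right divisor of $b$ ($b\succeq a$) if $b\in Ma$. $M$ is Gaussian if it is Noetherian, cancellative, and every pair of elements has a right lcm $a\vee b$ (least upper bound for $\preceq$) and a left lcm $a\mathbin{\tilde\vee}b$ (least element, in the order where $y$ is above $x$ when $y\succeq x$, having both $a$ and $b$ as right divisors). Then every pair also has a greatest common left divisor $a\wedge b$ and a greatest common right divisor $a\mathbin{\tilde\wedge}b$. A Garside group is a group $G$ with a finite subset $S$ (the simple elements) and an element $\Delta$ (the Garside element) such that the monoid $G^+$ generated by $S$ is Gaussian with group of fractions $G$, $\Delta\in G^+$ is balanced (its left and right divisors coincide), and $S$ is the set of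 divisors of $\Delta$ in $G^+$. The orders extend to $G$: $a\preceq b$ iff $a^{-1}b\in G^+$, and $b\succeq a$ iff $ba^{-1}\in G^+$. Put $\tau(a)=\Delta^{-1}a\Delta$, and for $s\in S$ put $\partial(s)=s^{-1}\Delta$, so $\partial^{-1}(s)=\Delta s^{-1}$. An element $a\neq1$ of $G^+$ is an atom if $a=bc$ with $b,c\in G^+$ implies $b=1$ or $c=1$. For $a\in G^+$, $\|a\|$ is the maximum number of atoms in an expression of $a$ as a product of atoms. Infimum, supremum, normal form. For $a,b\in G$, $a\le b$ means $b=cac'$ for some $c,c'\in G^+$. For $a\in G$, $\inf a$ and $\sup a$ are the maximal $m\in\mathbb Z$ and minimal $n\in\mathbb Z$ with $\Delta^m\le a\le\Delta^n$. The (left) normal form of $a$ is the unique expression $a=\Delta^{\inf a}s_1\cdots s_l$ with $s_j=\Delta\wedge(s_j\cdots s_l)\in S$ for all $j$ and $s_l\neq1$; here $l=\sup a-\inf a$. Tuples. $\mathbb Z^r$ is ordered coordinatewise; $e_i\in\mathbb Z^r$ has $i$-th coordinate $1$ and all others $0$. For $a=(a_1,\dotsc,a_r)\in G^r$ and $g\in G$: $a^g=(g^{-1}a_1g,\dotsc,g^{-1}a_rg)$, $a^G=\{a^g: g\in G\}$, $\inf a=(\inf a_1,\dotsc,\inf a_r)$, $\sup a=(\sup a_1,\dotsc,\sup a_r)$. For $p\le q$ in $\mathbb Z^r$, $[p,q]=\{a\in G^r: p\le\inf a,\ \sup a\le q\}$ (for $p\not\le q$, read this set as empty). Simultaneous cyclic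 sliding with respect to $[\tilde p,\tilde q]$. Let $b\in G^r$ satisfy $\tilde p_j-1\le\inf b_j$ and $\sup b_j\le\tilde q_j+1$ for all $j$, and let $b_j=\Delta^{\inf b_j}s^{(j)}_1\cdots s^{(j)}_{l_j}$ be the normal form (with the convention $s^{(j)}_1=s^{(j)}_{l_j}=1$ if $l_j=0$). Define $$x_b=\Bigl(\mathop{\tilde{\bigvee}}_{j:\ \tilde p_j=\inf b_j+1}\tau^{-\tilde p_j+1}\bigl(\partial^{-1}(s^{(j)}_1)\bigr)\Bigr)\mathbin{\tilde\vee}\Bigl(\mathop{\tilde{\bigvee}}_{j:\ \tilde q_j=\sup b_j-1}s^{(j)}_{l_j}\Bigr)\in S,$$ where $\tilde\bigvee$ denotes the left lcm of the indicated elements (an empty left lcm is $1$), and $\operatorname{sl}(b)=x_b\,b\,x_b^{-1}=(x_bb_1x_b^{-1},\dotsc,x_bb_rx_b^{-1})$. The tuple $\operatorname{sl}(b)$ again satisfies $\tilde p_j-1\le\inf\operatorname{sl}(b)_j$ and $\sup\operatorname{sl}(b)_j\le\tilde q_j+1$ for all $j$ (so $\operatorname{sl}$ can be iterated, with the infima, suprema and normal forms recomputed at each step). *)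

theory Defs
  imports "HOL-Algebra.Divisibility"
begin

section \<open>Gaussian monoids\<close>

text \<open>
  Left divisibility \<open>a \<preceq> b\<close> is the library's \<open>a divides b\<close>; hence
  \<open>gcdof\<close>, \<open>lcmof\<close> and \<open>somegcd\<close> are greatest common left divisors
  and right lcms. The mirrored notions are not in the library.
\<close>

definition right_divides :: "('a, 'b) monoid_scheme \<Rightarrow> 'a \<Rightarrow> 'a \<Rightarrow> bool" where
  "right_divides M a b \<longleftrightarrow> (\<exists>c\<in>carrier M. b = c \<otimes>\<^bsub>M\<^esub> a)"

text \<open>Left lcm of a set of elements; for the empty set of a Gaussian monoid it is the identity.\<close>

definition is_left_lcm :: "('a, 'b) monoid_scheme \<Rightarrow> 'a set \<Rightarrow> 'a \<Rightarrow> bool" where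
  "is_left_lcm M X c \<longleftrightarrow> c \<in> carrier M \<and> (\<forall>x\<in>X. right_divides M x c) \<and>
     (\<forall>d\<in>carrier M. (\<forall>x\<in>X. right_divides M x d) \<longrightarrow> right_divides M c d)"

definition left_lcm :: "('a, 'b) monoid_scheme \<Rightarrow> 'a set \<Rightarrow> 'a" where
  "left_lcm M X = (THE c. is_left_lcm M X c)"

definition list_product :: "('a, 'b) monoid_scheme \<Rightarrow> 'a list \<Rightarrow> 'a" where
  "list_product M xs = foldr (\<otimes>\<^bsub>M\<^esub>) xs \<one>\<^bsub>M\<^esub>"

definition noetherian_monoid :: "('a, 'b) monoid_scheme \<Rightarrow> bool" where
  "noetherian_monoid M \<longleftrightarrow> (\<forall>a\<in>carrier M. \<exists>n::nat. \<forall>xs.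
     set xs \<subseteq> carrier M - {\<one>\<^bsub>M\<^esub>} \<and> list_product M xs = a \<longrightarrow> length xs \<le> n)"

locale gaussian_monoid = monoid_cancel M for M (structure) +
  assumes noetherian: "noetherian_monoid M"
    and ex_right_lcm: "\<lbrakk>a \<in> carrier M; b \<in> carrier M\<rbrakk> \<Longrightarrow> \<exists>c\<in>carrier M. c lcmof a b"
    and ex_left_lcm: "\<lbrakk>a \<in> carrier M; b \<in> carrier M\<rbrakk> \<Longrightarrow> \<exists>c. is_left_lcm M {a, b} c"

definition atoms :: "('a, 'b) monoid_scheme \<Rightarrow> 'a set" where
  "atoms M = {a \<in> carrier M. a \<noteq> \<one>\<^bsub>M\<^esub> \<and>
     (\<forall>b\<in>carrier M. \<forall>c\<in>carrier M. a = b \<otimes>\<^bsub>M\<^esub> c \<longrightarrow> b = \<one>\<^bsub>M\<^esub> \<or> c = \<one>\<^bsub>M\<^esub>)}"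

definition atom_norm :: "('a, 'b) monoid_scheme \<Rightarrow> 'a \<Rightarrow> nat" where
  "atom_norm M a = Max {length xs |xs. set xs \<subseteq> atoms M \<and> list_product M xs = a}"


section \<open>Garside groups\<close>

inductive_set submonoid_generate :: "('a, 'b) monoid_scheme \<Rightarrow> 'a set \<Rightarrow> 'a set"
  for G and S where
    one: "\<one>\<^bsub>G\<^esub> \<in> submonoid_generate G S"
  | incl: "s \<in> S \<Longrightarrow> s \<in> submonoid_generate G S"
  | mult: "a \<in> submonoid_generate G S \<Longrightarrow> b \<in> submonoid_generate G S \<Longrightarrow>
      a \<otimes>\<^bsub>G\<^esub> b \<in> submonoid_generate G S"

definition positive_monoid :: "('a, 'b) monoid_scheme \<Rightarrow> 'a set \<Rightarrow> ('a, 'b) monoid_scheme" where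
  "positive_monoid G S = G\<lparr>carrier := submonoid_generate G S\<rparr>"

text \<open>
  A Gaussian monoid satisfies the Ore conditions, so a group containing it is its group of
  fractions iff every group element is a quotient of two elements of the monoid.
\<close>

locale garside_group = group G for G (structure) +
  fixes S :: "'a set" and \<Delta> :: 'a
  assumes simples_finite: "finite S"
    and simples_carrier: "S \<subseteq> carrier G"
    and gaussian: "gaussian_monoid (positive_monoid G S)"
    and fractions: "g \<in> carrier G \<Longrightarrow>
      \<exists>a\<in>carrier (positive_monoid G S). \<exists>b\<in>carrier (positive_monoid G S). g = inv a \<otimes> b"
    and Delta_positive: "\<Delta> \<in> carrier (positive_monoid G S)"
    and Delta_balanced:
      "{s \<in> carrier (positive_monoid G S). s divides\<^bsub>positive_monoid G S\<^esub> \<Delta>} =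
       {s \<in> carrier (positive_monoid G S). right_divides (positive_monoid G S) s \<Delta>}"
    and simples_eq:
      "S = {s \<in> carrier (positive_monoid G S). s divides\<^bsub>positive_monoid G S\<^esub> \<Delta>}"
begin

abbreviation Gpos :: "('a, 'b) monoid_scheme" where
  "Gpos \<equiv> positive_monoid G S"

definition tau_pow :: "int \<Rightarrow> 'a \<Rightarrow> 'a" where
  "tau_pow k a = inv (\<Delta> [^] k) \<otimes> a \<otimes> \<Delta> [^] k"

definition compl_inv :: "'a \<Rightarrow> 'a" where  \<comment> \<open>inverse of \<open>\<partial>(s) = s\<^sup>-\<^sup>1 \<Delta>\<close>\<close>
  "compl_inv s = \<Delta> \<otimes> inv s"

definition sub_le :: "'a \<Rightarrow> 'a \<Rightarrow> bool" where
  "sub_le a b \<longleftrightarrow> (\<exists>c\<in>carrier Gpos. \<exists>c'\<in>carrier Gpos. b = c \<otimes> a \<otimes> c')"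

definition g_inf :: "'a \<Rightarrow> int" where
  "g_inf a = (GREATEST m. sub_le (\<Delta> [^] m) a)"

definition g_sup :: "'a \<Rightarrow> int" where
  "g_sup a = (LEAST n. sub_le a (\<Delta> [^] n))"

text \<open>The list of simple factors of the left normal form, without the power of \<open>\<Delta>\<close>.\<close>

definition is_normal_form :: "'a \<Rightarrow> 'a list \<Rightarrow> bool" where
  "is_normal_form a ss \<longleftrightarrow>
     a = \<Delta> [^] g_inf a \<otimes> list_product G ss \<and>
     set ss \<subseteq> S \<and>
     (\<forall>j<length ss. ss ! j = somegcd Gpos \<Delta> (list_product G (drop j ss))) \<and>
     (ss \<noteq> [] \<longrightarrow> last ss \<noteq> \<one>)"

definition normal_form :: "'a \<Rightarrow> 'a list" where
  "normal_form a = (THE ss. is_normal_form a ss)"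

definition first_factor :: "'a \<Rightarrow> 'a" where
  "first_factor a = (if normal_form a = [] then \<one> else hd (normal_form a))"

definition last_factor :: "'a \<Rightarrow> 'a" where
  "last_factor a = (if normal_form a = [] then \<one> else last (normal_form a))"


text \<open>
  \<open>r\<close>-tuples of group elements are the extensional functions on \<open>{1..r}\<close>;
  integer tuples are functions of which only the values on \<open>{1..r}\<close> matter.
\<close>

definition tuples :: "nat \<Rightarrow> (nat \<Rightarrow> 'a) set" where
  "tuples r = ({1..r} \<rightarrow>\<^sub>E carrier G)"

definition conj_tuple :: "nat \<Rightarrow> (nat \<Rightarrow> 'a) \<Rightarrow> 'a \<Rightarrow> nat \<Rightarrow> 'a" where
  "conj_tuple r a g = (\<lambda>j\<in>{1..r}. inv g \<otimes> a j \<otimes> g)"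

definition conj_class :: "nat \<Rightarrow> (nat \<Rightarrow> 'a) \<Rightarrow> (nat \<Rightarrow> 'a) set" where
  "conj_class r a = conj_tuple r a ` carrier G"

definition interval :: "nat \<Rightarrow> (nat \<Rightarrow> int) \<Rightarrow> (nat \<Rightarrow> int) \<Rightarrow> (nat \<Rightarrow> 'a) set" where
  "interval r p q = {a \<in> tuples r.
     (\<forall>j\<in>{1..r}. p j \<le> q j) \<and> (\<forall>j\<in>{1..r}. p j \<le> g_inf (a j) \<and> g_sup (a j) \<le> q j)}"

definition slide_elt :: "nat \<Rightarrow> (nat \<Rightarrow> int) \<Rightarrow> (nat \<Rightarrow> int) \<Rightarrow> (nat \<Rightarrow> 'a) \<Rightarrow> 'a" where
  "slide_elt r p q b =
     left_lcm Gpos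
      {left_lcm Gpos {tau_pow (- p j + 1) (compl_inv (first_factor (b j))) |j.
          j \<in> {1..r} \<and> p j = g_inf (b j) + 1},
       left_lcm Gpos {last_factor (b j) |j. j \<in> {1..r} \<and> q j = g_sup (b j) - 1}}"

definition slide :: "nat \<Rightarrow> (nat \<Rightarrow> int) \<Rightarrow> (nat \<Rightarrow> int) \<Rightarrow> (nat \<Rightarrow> 'a) \<Rightarrow> nat \<Rightarrow> 'a" where
  "slide r p q b = (\<lambda>j\<in>{1..r}. slide_elt r p q b \<otimes> b j \<otimes> inv (slide_elt r p q b))"

end

definition unit_tuple :: "nat \<Rightarrow> nat \<Rightarrow> int" where
  "unit_tuple i = (\<lambda>j. if j = i then 1 else 0)"

end

theory Submission
  imports Defs
begin

text \<open>
  Write \<open>g \<lesssim> h\<close> for \<open>h g\<^sup>-\<^sup>1 \<in> G\<^sup>+\<close>. The tuple \<open>g a g\<^sup>-\<^sup>1\<close> lies in the target interval iff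
  \<open>\<psi>(g) \<lesssim> g\<close> for finitely many order automorphisms \<open>\<psi>(g) = \<Delta>\<^sup>m g c\<close>, which commute with
  \<open>g \<mapsto> \<Delta> g\<close>; call such \<open>g\<close> stable. The product \<open>y\<^sub>k\<close> of the first \<open>k\<close> sliding elements satisfies
  \<open>y\<^sub>0 = 1\<close>, and \<open>y\<^sub>k\<^sub>+\<^sub>1\<close> is the join of \<open>y\<^sub>k\<close> and all \<open>\<psi>(y\<^sub>k)\<close>. It is bounded by any stable \<open>g \<in> G\<^sup>+\<close>,
  so the \<open>y\<^sub>k\<close> reach a limit \<open>z\<close>, the least stable element of \<open>G\<^sup>+\<close>.

  Put \<open>e = \<Delta>\<^sup>-\<^sup>1 z\<close>, which is stable, and let \<open>w\<^sub>k\<close> be the join of \<open>y\<^sub>k\<close> and \<open>e\<close>. The \<open>w\<^sub>k\<close> increase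
  strictly until they reach \<open>z\<close>, inside the interval from \<open>e\<close> to \<open>z = \<Delta> e\<close>, and \<open>w\<^sub>0 \<noteq> e\<close> because \<open>z\<close> is
  least; hence \<open>w\<^sub>n = z\<close> for \<open>n = \<parallel>\<Delta>\<parallel> - 1\<close>. Then \<open>z\<close> is the join of \<open>y\<^sub>n\<close> and \<open>\<Delta>\<^sup>-\<^sup>1 z\<close>; iterating,
  it is the join of \<open>y\<^sub>n\<close> and \<open>\<Delta>\<^sup>-\<^sup>N z\<close> for every \<open>N\<close>, so \<open>z = y\<^sub>n\<close>.
\<close>

section \<open>Products of lists, and extrema of sets of integers\<close>

lemma list_product_Nil [simp]: "list_product M [] = \<one>\<^bsub>M\<^esub>"
  and list_product_Cons [simp]: "list_product M (x # xs) = x \<otimes>\<^bsub>M\<^esub> list_product M xs"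
  by (simp_all add: list_product_def)

lemma (in monoid) list_product_closed [simp]:
  "set xs \<subseteq> carrier G \<Longrightarrow> list_product G xs \<in> carrier G"
  by (induction xs) auto

lemma (in monoid) list_product_append:
  "set xs \<subseteq> carrier G \<Longrightarrow> set ys \<subseteq> carrier G \<Longrightarrow>
    list_product G (xs @ ys) = list_product G xs \<otimes> list_product G ys"
  by (induction xs) (auto simp: m_assoc)

text \<open>\<open>GREATEST\<close> is meaningful only when a maximum exists. It does here because
  the distance to the bound \<open>k\<close> is a natural number and attains a least value where
  \<open>Q\<close> holds.\<close>

lemma int_le_Greatest_iff:
  fixes Q :: "int \<Rightarrow> bool"
  assumes "Q m0" and bound: "\<And>m. Q m \<Longrightarrow> m \<le> k"
    and down: "\<And>m n. Q m \<Longrightarrow> n \<le> m \<Longrightarrow> Q n"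
  shows "m \<le> (GREATEST x. Q x) \<longleftrightarrow> Q m"
proof -
  define n where "n = (LEAST n. Q (k - int n))"
  have "Q (k - int (nat (k - m0)))"
    using assms by simp
  then have Qn: "Q (k - int n)"
    unfolding n_def by (rule LeastI)
  have ub: "x \<le> k - int n" if "Q x" for x
  proof -
    have "n \<le> nat (k - x)"
      unfolding n_def using that bound[of x] by (intro Least_le) simp
    then show ?thesis
      using bound[OF that] by simp
  qed
  have "(GREATEST x. Q x) = k - int n"
    using Qn ub by (rule Greatest_equality)
  then show ?thesis
    using down[OF Qn] ub by metis
qed

text \<open>Reflection \<open>x \<mapsto> - x\<close> of the statement on
  \<open>GREATEST\<close>.\<close>

lemma int_Least_le_iff:
  fixes Q :: "int \<Rightarrow> bool"
  assumes "Q m0" and bound: "\<And>m. Q m \<Longrightarrow> k \<le> m"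
    and up: "\<And>m n. Q m \<Longrightarrow> m \<le> n \<Longrightarrow> Q n"
  shows "(LEAST x. Q x) \<le> m \<longleftrightarrow> Q m"
proof -
  define M where "M = (GREATEST x. Q (- x))"
  have M: "x \<le> M \<longleftrightarrow> Q (- x)" for x
    unfolding M_def
  proof (rule int_le_Greatest_iff[of _ "- m0" "- k"])
    show "m \<le> - k" if "Q (- m)" for m
      using bound[OF that] by simp
    show "Q (- n)" if "Q (- m)" "n \<le> m" for m n
      using up[OF that(1), of "- n"] that(2) by simp
  qed (use assms(1) in simp)
  have "(LEAST x. Q x) = - M"
    using M[of M] M[of "- x" for x] by (intro Least_equality) (auto simp: minus_le_iff)
  then show ?thesis
    using M[of "- m"] by (simp add: minus_le_iff)
qed

section \<open>Gaussian monoids\<close>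

context gaussian_monoid
begin

lemma noetherian_bound:
  assumes "a \<in> carrier M"
  obtains n where "\<And>xs. set xs \<subseteq> carrier M - {\<one>} \<Longrightarrow> list_product M xs = a \<Longrightarrow> length xs \<le> n"
  using noetherian assms unfolding noetherian_monoid_def by blast

text \<open>Otherwise repeating the block \<open>[u, v]\<close> would give arbitrarily long
  factorizations of \<open>\<one>\<close> into nonidentity elements, against Noetherianity.\<close>

lemma mult_eq_one:
  assumes u: "u \<in> carrier M" and v: "v \<in> carrier M" and uv: "u \<otimes> v = \<one>"
  shows "u = \<one>"
proof (rule ccontr)
  assume u1: "u \<noteq> \<one>"
  then have v1: "v \<noteq> \<one>"
    using u uv by auto
  obtain n where n: "\<And>xs. set xs \<subseteq> carrier M - {\<one>} \<Longrightarrow> list_product M xs = \<one> \<Longrightarrow> length xs \<le> n"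
    using noetherian_bound[OF one_closed] by blast
  define ws where "ws k = concat (replicate k [u, v])" for k :: nat
  have "set (ws k) \<subseteq> carrier M - {\<one>} \<and> list_product M (ws k) = \<one> \<and> length (ws k) = 2 * k" for k
  proof (induction k)
    case (Suc k)
    then show ?case
      using u v u1 v1 uv by (auto simp: ws_def m_assoc[symmetric])
  qed (simp add: ws_def)
  from n[of "ws (Suc n)"] this[of "Suc n"] show False
    by auto
qed

text \<open>A longest factorization into nonidentity elements consists of atoms, since a factor that
  is not an atom could be split further. Noetherianity makes both maxima exist.\<close>

lemma length_le_atom_norm:
  assumes xs: "set xs \<subseteq> carrier M - {\<one>}" "list_product M xs = a"
  shows "length xs \<le> atom_norm M a"
proof -
  have a: "a \<in> carrier M"
    using xs list_product_closed[of xs] by auto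
  obtain n where n: "\<And>xs. set xs \<subseteq> carrier M - {\<one>} \<Longrightarrow> list_product M xs = a \<Longrightarrow> length xs \<le> n"
    using noetherian_bound[OF a] by blast
  define Q where "Q ys \<longleftrightarrow> set ys \<subseteq> carrier M - {\<one>} \<and> list_product M ys = a" for ys
  define N where "N = (GREATEST k. \<exists>ys. Q ys \<and> length ys = k)"
  have bound: "\<And>k. (\<exists>ys. Q ys \<and> length ys = k) \<Longrightarrow> k \<le> n"
    using n by (auto simp: Q_def)
  have ex: "\<exists>ys. Q ys \<and> length ys = length xs"
    using xs by (auto simp: Q_def)
  have le: "length xs \<le> N"
    unfolding N_def using ex by (rule Greatest_le_nat[OF _ bound])
  have "\<exists>ys. Q ys \<and> length ys = N"
    unfolding N_def using ex by (rule GreatestI_nat[OF _ bound])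
  then obtain ys where ys: "Q ys" "length ys = N"
    by blast
  have "z \<in> atoms M" if z: "z \<in> set ys" for z
  proof (rule ccontr)
    assume "z \<notin> atoms M"
    then obtain b c where bc: "b \<in> carrier M" "c \<in> carrier M" "z = b \<otimes> c" "b \<noteq> \<one>" "c \<noteq> \<one>"
      using z ys unfolding atoms_def Q_def by blast
    obtain us vs where split: "ys = us @ z # vs"
      using split_list[OF z] by blast
    have "set us \<subseteq> carrier M" "set vs \<subseteq> carrier M"
      using ys(1) unfolding split Q_def by auto
    then have "Q (us @ b # c # vs)"
      using ys(1) bc unfolding split Q_def by (auto simp: list_product_append m_assoc)
    then have "length (us @ b # c # vs) \<le> N"
      unfolding N_def by (intro Greatest_le_nat[OF _ bound]) auto
    then show False
      using ys(2) split by simp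
  qed
  then have "length ys \<in> {length xs |xs. set xs \<subseteq> atoms M \<and> list_product M xs = a}"
    using ys(1) by (auto simp: Q_def)
  moreover have "{length xs |xs. set xs \<subseteq> atoms M \<and> list_product M xs = a} \<subseteq> {..n}"
    using n by (fastforce simp: atoms_def)
  ultimately have "length ys \<le> atom_norm M a"
    unfolding atom_norm_def by (metis (no_types, lifting) Max_ge finite_atMost finite_subset)
  then show ?thesis
    using le ys(2) by simp
qed

lemma right_divides_trans:
  "a \<in> carrier M \<Longrightarrow> right_divides M a b \<Longrightarrow> right_divides M b c \<Longrightarrow> right_divides M a c"
  unfolding right_divides_def by (metis m_assoc m_closed)

text \<open>Cancelling \<open>a\<close> leaves \<open>v \<otimes> u = \<one>\<close>, so
  \<open>v\<close> is trivial by \<open>mult_eq_one\<close>.\<close>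

lemma right_divides_antisym:
  assumes "a \<in> carrier M" "b \<in> carrier M" "right_divides M a b" "right_divides M b a"
  shows "a = b"
proof -
  obtain u v where uv: "u \<in> carrier M" "v \<in> carrier M" "b = u \<otimes> a" "a = v \<otimes> b"
    using assms(3,4) unfolding right_divides_def by blast
  then have "(v \<otimes> u) \<otimes> a = \<one> \<otimes> a"
    using assms(1) by (simp add: m_assoc)
  then have "v \<otimes> u = \<one>"
    using uv assms(1) by (metis m_closed one_closed r_cancel)
  then have "v = \<one>"
    using mult_eq_one uv by blast
  then show ?thesis
    using uv(4) assms(2) by simp
qed

lemma ex_left_lcm_finite:
  assumes "finite X" "X \<subseteq> carrier M"
  shows "\<exists>c. is_left_lcm M X c"
  using assms
proof (induction X)
  case empty
  have "is_left_lcm M {} \<one>"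
    by (auto simp: is_left_lcm_def right_divides_def)
  then show ?case ..
next
  case (insert x X)
  then obtain c where c: "is_left_lcm M X c"
    by auto
  then have cM: "c \<in> carrier M"
    by (simp add: is_left_lcm_def)
  obtain d where d: "is_left_lcm M {x, c} d"
    using ex_left_lcm[of x c] insert.prems cM by auto
  have "right_divides M y d" if "y \<in> X" for y
    using that c d insert.prems right_divides_trans[of y c d] by (auto simp: is_left_lcm_def)
  then have "is_left_lcm M (insert x X) d"
    using c d by (auto simp: is_left_lcm_def)
  then show ?case ..
qed

lemma is_left_lcm_left_lcm:
  assumes "finite X" "X \<subseteq> carrier M"
  shows "is_left_lcm M X (left_lcm M X)"
proof -
  have "c = d" if "is_left_lcm M X c" "is_left_lcm M X d" for c d
    using that right_divides_antisym[of c d] by (auto simp: is_left_lcm_def)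
  then have "\<exists>!c. is_left_lcm M X c"
    using ex_left_lcm_finite[OF assms] by blast
  then show ?thesis
    unfolding left_lcm_def by (rule theI')
qed

lemma left_lcm_closed:
  "finite X \<Longrightarrow> X \<subseteq> carrier M \<Longrightarrow> left_lcm M X \<in> carrier M"
  using is_left_lcm_left_lcm by (auto simp: is_left_lcm_def)

lemma left_lcm_right_divides_iff:
  assumes "finite X" "X \<subseteq> carrier M" "d \<in> carrier M"
  shows "right_divides M (left_lcm M X) d \<longleftrightarrow> (\<forall>x\<in>X. right_divides M x d)"
proof
  assume *: "right_divides M (left_lcm M X) d"
  have "right_divides M x d" if "x \<in> X" for x
    using that assms is_left_lcm_left_lcm[OF assms(1,2)] right_divides_trans[OF _ _ *]
    by (auto simp: is_left_lcm_def)
  then show "\<forall>x\<in>X. right_divides M x d" ..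
qed (use is_left_lcm_left_lcm[OF assms(1,2)] assms in \<open>auto simp: is_left_lcm_def\<close>)

end

section \<open>The positive monoid and its orders on the group\<close>

context garside_group
begin

abbreviation D :: "int \<Rightarrow> 'a" where "D k \<equiv> \<Delta> [^] k"

definition P :: "'a set" where "P = carrier Gpos"

lemma Gpos_simps [simp]:
  "carrier Gpos = P" "x \<otimes>\<^bsub>Gpos\<^esub> y = x \<otimes> y" "\<one>\<^bsub>Gpos\<^esub> = \<one>"
  by (simp_all add: P_def positive_monoid_def)

lemma list_product_Gpos: "list_product Gpos xs = list_product G xs"
  by (induction xs) simp_all

lemma P_eq: "P = submonoid_generate G S"
  by (simp add: P_def positive_monoid_def)

lemma P_closed [simp]: assumes "x \<in> P" shows "x \<in> carrier G"
  using assms simples_carrier unfolding P_eq by (induction rule: submonoid_generate.induct) auto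

lemma one_in_P [simp]: "\<one> \<in> P"
  unfolding P_eq by (rule submonoid_generate.one)

lemma mult_in_P [simp]: "x \<in> P \<Longrightarrow> y \<in> P \<Longrightarrow> x \<otimes> y \<in> P"
  unfolding P_eq by (rule submonoid_generate.mult)

lemma S_subset_P: "S \<subseteq> P"
  unfolding P_eq by (auto intro: submonoid_generate.incl)

sublocale Gpos: gaussian_monoid Gpos
  by (rule gaussian)

lemma Delta_in_P [simp]: "\<Delta> \<in> P"
  using Delta_positive by simp

lemma inv_mult_cancel [simp]:
  assumes "x \<in> carrier G" "y \<in> carrier G"
  shows "inv x \<otimes> (x \<otimes> y) = y" "x \<otimes> (inv x \<otimes> y) = y"
  using assms by (simp_all add: m_assoc[symmetric])

lemma D_closed [simp]: "D k \<in> carrier G"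
  by simp

lemma D_mult: "D j \<otimes> D k = D (j + k)"
  by (simp add: int_pow_mult)

lemma D_mult_left: "y \<in> carrier G \<Longrightarrow> D j \<otimes> (D k \<otimes> y) = D (j + k) \<otimes> y"
  by (simp add: m_assoc[symmetric] D_mult)

lemma inv_D: "inv (D k) = D (- k)"
  by (simp add: int_pow_neg)

lemma D_0 [simp]: "D 0 = \<one>" and D_1: "D 1 = \<Delta>"
  by (simp_all add: int_pow_1)

lemmas D_simps = m_assoc inv_mult_group D_mult D_mult_left inv_D

lemma S_iff_left: "s \<in> S \<longleftrightarrow> s \<in> P \<and> inv s \<otimes> \<Delta> \<in> P"
proof -
  have "s divides\<^bsub>Gpos\<^esub> \<Delta> \<longleftrightarrow> inv s \<otimes> \<Delta> \<in> P" if "s \<in> P"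
    using that unfolding factor_def
    by (metis Gpos_simps(1,2) P_closed Delta_in_P inv_mult_cancel)
  then show ?thesis
    by (subst simples_eq) auto
qed

text \<open>Balancedness of \<Delta> enters here; this left-right symmetry is the source of the
  invariance of \<open>P\<close> under conjugation by \<Delta>.\<close>

lemma S_iff_right: "s \<in> S \<longleftrightarrow> s \<in> P \<and> \<Delta> \<otimes> inv s \<in> P"
proof -
  have "right_divides Gpos s \<Delta> \<longleftrightarrow> \<Delta> \<otimes> inv s \<in> P" if "s \<in> P"
    using that unfolding right_divides_def
    by (metis Gpos_simps(1,2) P_closed Delta_in_P inv_closed inv_solve_right m_closed)
  then show ?thesis
    by (subst simples_eq, subst Delta_balanced) auto
qed

text \<open>Conjugation by \<Delta> is the square of the complement
  \<open>s \<mapsto> inv s \<otimes> \<Delta>\<close>, which maps \<open>S\<close> to itself because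
  \<open>s\<close> and its complement multiply to \<Delta>. The inverse conjugation is the square of
  \<open>s \<mapsto> \<Delta> \<otimes> inv s\<close>.\<close>

lemma conj_Delta_S:
  assumes "s \<in> S"
  shows "inv \<Delta> \<otimes> s \<otimes> \<Delta> \<in> S" "\<Delta> \<otimes> s \<otimes> inv \<Delta> \<in> S"
proof -
  have s: "s \<in> P" "inv s \<otimes> \<Delta> \<in> P" "\<Delta> \<otimes> inv s \<in> P"
    using assms S_iff_left S_iff_right by auto
  have "\<Delta> \<otimes> inv (inv s \<otimes> \<Delta>) \<in> P" "inv (\<Delta> \<otimes> inv s) \<otimes> \<Delta> \<in> P"
    using s by (simp_all add: inv_mult_group m_assoc)
  then have "inv s \<otimes> \<Delta> \<in> S" "\<Delta> \<otimes> inv s \<in> S"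
    using s S_iff_left S_iff_right by auto
  then have *: "inv (inv s \<otimes> \<Delta>) \<otimes> \<Delta> \<in> P" "\<Delta> \<otimes> inv (\<Delta> \<otimes> inv s) \<in> P"
    using S_iff_left S_iff_right by auto
  have "\<Delta> \<otimes> inv (inv (inv s \<otimes> \<Delta>) \<otimes> \<Delta>) \<in> P" "inv (\<Delta> \<otimes> inv (\<Delta> \<otimes> inv s)) \<otimes> \<Delta> \<in> P"
    using s by (simp_all add: inv_mult_group m_assoc)
  with * have "inv (inv s \<otimes> \<Delta>) \<otimes> \<Delta> \<in> S" "\<Delta> \<otimes> inv (\<Delta> \<otimes> inv s) \<in> S"
    using S_iff_left S_iff_right by auto
  then show "inv \<Delta> \<otimes> s \<otimes> \<Delta> \<in> S" "\<Delta> \<otimes> s \<otimes> inv \<Delta> \<in> S"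
    using s by (simp_all add: inv_mult_group m_assoc)
qed

lemma conj_Delta_P:
  assumes "x \<in> P"
  shows "inv \<Delta> \<otimes> x \<otimes> \<Delta> \<in> P" "\<Delta> \<otimes> x \<otimes> inv \<Delta> \<in> P"
proof -
  have "x \<in> P \<and> inv \<Delta> \<otimes> x \<otimes> \<Delta> \<in> P \<and> \<Delta> \<otimes> x \<otimes> inv \<Delta> \<in> P"
    using assms unfolding P_eq
  proof (induction rule: submonoid_generate.induct)
    case one
    then show ?case by (auto simp: P_eq[symmetric])
  next
    case (incl s)
    then show ?case using conj_Delta_S[of s] S_subset_P unfolding P_eq by auto
  next
    case (mult a b)
    note ab = mult.IH[folded P_eq]
    have eq: "inv \<Delta> \<otimes> (a \<otimes> b) \<otimes> \<Delta> = (inv \<Delta> \<otimes> a \<otimes> \<Delta>) \<otimes> (inv \<Delta> \<otimes> b \<otimes> \<Delta>)"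
      "\<Delta> \<otimes> (a \<otimes> b) \<otimes> inv \<Delta> = (\<Delta> \<otimes> a \<otimes> inv \<Delta>) \<otimes> (\<Delta> \<otimes> b \<otimes> inv \<Delta>)"
      using ab by (simp_all add: m_assoc)
    show ?case
      unfolding P_eq[symmetric] eq using ab by (simp only: mult_in_P)
  qed
  then show "inv \<Delta> \<otimes> x \<otimes> \<Delta> \<in> P" "\<Delta> \<otimes> x \<otimes> inv \<Delta> \<in> P"
    by auto
qed

lemma conj_D_P: assumes "x \<in> P" shows "D (- k) \<otimes> x \<otimes> D k \<in> P"
proof -
  have inv_Delta: "inv \<Delta> = D (- 1)"
    by (metis D_1 inv_D)
  have "D (- k) \<otimes> x \<otimes> D k \<in> P \<and> x \<in> P"
  proof (induction k rule: int_induct[where k = 0])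
    case base
    then show ?case using assms by simp
  next
    case (step1 i)
    have "D (- (i + 1)) \<otimes> x \<otimes> D (i + 1) = D (- 1) \<otimes> (D (- i) \<otimes> x \<otimes> D i) \<otimes> D 1"
      using step1 by (simp add: D_simps minus_diff_commute del: int_pow_1)
    then show ?case
      unfolding D_1 inv_Delta[symmetric] using conj_Delta_P step1 by simp
  next
    case (step2 i)
    have "D (- (i - 1)) \<otimes> x \<otimes> D (i - 1) = D 1 \<otimes> (D (- i) \<otimes> x \<otimes> D i) \<otimes> D (- 1)"
      using step2 by (simp add: D_simps del: int_pow_1)
    then show ?case
      unfolding D_1 inv_Delta[symmetric] using conj_Delta_P step2 by simp
  qed
  then show ?thesis ..
qed

lemma conj_D_P_iff:
  assumes "x \<in> carrier G" shows "D (- k) \<otimes> x \<otimes> D k \<in> P \<longleftrightarrow> x \<in> P"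
proof
  assume "D (- k) \<otimes> x \<otimes> D k \<in> P"
  from conj_D_P[OF this, of "- k"] show "x \<in> P"
    using assms by (simp add: D_simps)
qed (rule conj_D_P)

lemma D_commute_P_iff:
  assumes "x \<in> carrier G" shows "x \<otimes> D k \<in> P \<longleftrightarrow> D k \<otimes> x \<in> P"
  using conj_D_P_iff[of "D k \<otimes> x" k] assms by (simp add: D_simps)

lemma D_in_P: assumes "k \<ge> 0" shows "D k \<in> P"
proof -
  have "D (int n) \<in> P" for n
    by (induction n) (simp_all add: D_mult[symmetric] D_1 del: of_nat_Suc add: of_nat_Suc)
  from this[of "nat k"] show ?thesis using assms by simp
qed


text \<open>A simple element needs one factor \<Delta>. For a product the exponents add, because the
  complement of \<open>a\<close> stays positive when it is moved past the power of \<Delta>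
  belonging to \<open>b\<close>.\<close>

lemma ex_D_right_multiple:
  assumes "x \<in> P" shows "\<exists>k\<ge>0. inv x \<otimes> D k \<in> P"
  using assms unfolding P_eq
proof (induction rule: submonoid_generate.induct)
  case one
  then show ?case by (intro exI[of _ 0]) (simp add: P_eq[symmetric])
next
  case (incl s)
  then show ?case
    using S_iff_left by (intro exI[of _ 1]) (simp add: D_1 P_eq[symmetric])
next
  case (mult a b)
  then have ab: "a \<in> P" "b \<in> P"
    by (simp_all add: P_eq)
  from mult.IH obtain j k where jk: "j \<ge> 0" "k \<ge> 0" "inv a \<otimes> D j \<in> P" "inv b \<otimes> D k \<in> P"
    by (auto simp: P_eq)
  have "inv (a \<otimes> b) \<otimes> D (j + k) = (inv b \<otimes> D k) \<otimes> (D (- k) \<otimes> (inv a \<otimes> D j) \<otimes> D k)"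
    using ab by (simp add: D_simps)
  then show ?case
    using jk conj_D_P[OF jk(3), of k] by (intro exI[of _ "j + k"]) (simp add: P_eq[symmetric])
qed

lemma ex_D_mult_in_P:
  assumes "g \<in> carrier G" shows "\<exists>k\<ge>0. D k \<otimes> g \<in> P"
proof -
  obtain a b where ab: "a \<in> P" "b \<in> P" "g = inv a \<otimes> b"
    using fractions[OF assms] by auto
  obtain k where k: "k \<ge> 0" "inv a \<otimes> D k \<in> P"
    using ex_D_right_multiple[OF ab(1)] by blast
  then have "D k \<otimes> inv a \<in> P"
    using ab by (simp add: D_commute_P_iff)
  then have "(D k \<otimes> inv a) \<otimes> b \<in> P"
    using ab by simp
  then show ?thesis
    using ab k by (auto simp: m_assoc)
qed

lemma inv_in_P_imp_one:
  assumes "x \<in> P" "inv x \<in> P" shows "x = \<one>"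
  using Gpos.mult_eq_one[of x "inv x"] assms by simp

text \<open>Here \<open>ex_D_mult_in_P\<close> makes every group element positive, hence also every
  inverse.\<close>

lemma Delta_one_imp_trivial:
  assumes "\<Delta> = \<one>" "g \<in> carrier G" shows "g = \<one>"
proof -
  have *: "h \<in> P" if "h \<in> carrier G" for h
    using ex_D_mult_in_P[OF that] that assms(1) by simp
  show ?thesis
    by (rule inv_in_P_imp_one) (use * assms(2) in auto)
qed

text \<open>Without atoms only the empty list counts. Since \<open>0 - 1 = 0\<close> for natural
  numbers, no slide is performed in this case.\<close>

lemma atom_norm_trivial:
  assumes "\<Delta> = \<one>" shows "atom_norm Gpos \<Delta> = 0"
proof -
  have "atoms Gpos = {}"
    using Delta_one_imp_trivial[OF assms] by (auto simp: atoms_def)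
  then show ?thesis
    using assms by (simp add: atom_norm_def)
qed

lemma D_not_in_P:
  assumes "\<Delta> \<noteq> \<one>" "k < 0" shows "D k \<notin> P"
proof
  assume "D k \<in> P"
  then have "D (- 1 - k) \<otimes> D k \<in> P"
    using assms(2) D_in_P[of "- 1 - k"] by simp
  then have "inv \<Delta> \<in> P"
    by (simp add: D_mult D_1 int_pow_neg)
  then show False
    using inv_in_P_imp_one[of \<Delta>] assms(1) by simp
qed

section \<open>The two divisibility orders on the group and their joins\<close>

definition left_le :: "'a \<Rightarrow> 'a \<Rightarrow> bool" (infix "\<preceq>" 50) where
  "a \<preceq> b \<longleftrightarrow> inv a \<otimes> b \<in> P"

text \<open>Right divisibility extended to \<open>G\<close>. Invariance under right multiplication
  makes it the order in which conjugators are compared.\<close>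

definition right_le :: "'a \<Rightarrow> 'a \<Rightarrow> bool" (infix "\<lesssim>" 50) where
  "a \<lesssim> b \<longleftrightarrow> b \<otimes> inv a \<in> P"

lemma divides_Gpos_iff: "x \<in> P \<Longrightarrow> y \<in> P \<Longrightarrow> x divides\<^bsub>Gpos\<^esub> y \<longleftrightarrow> x \<preceq> y"
  unfolding factor_def left_le_def
  by (metis Gpos_simps(1,2) P_closed inv_mult_cancel)

lemma right_divides_Gpos_iff: "x \<in> P \<Longrightarrow> y \<in> P \<Longrightarrow> right_divides Gpos x y \<longleftrightarrow> x \<lesssim> y"
  unfolding right_divides_def right_le_def
  by (metis Gpos_simps(1,2) P_closed inv_closed inv_solve_right m_closed)

lemma left_le_refl [simp]: "a \<in> carrier G \<Longrightarrow> a \<preceq> a"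
  by (simp add: left_le_def)

lemma left_le_trans:
  assumes "a \<preceq> b" "b \<preceq> c" "a \<in> carrier G" "b \<in> carrier G" "c \<in> carrier G" shows "a \<preceq> c"
proof -
  have "inv a \<otimes> c = (inv a \<otimes> b) \<otimes> (inv b \<otimes> c)"
    using assms by (simp add: m_assoc)
  then show ?thesis using assms by (simp add: left_le_def)
qed

lemma left_le_mult_left_iff:
  "a \<in> carrier G \<Longrightarrow> b \<in> carrier G \<Longrightarrow> c \<in> carrier G \<Longrightarrow> c \<otimes> a \<preceq> c \<otimes> b \<longleftrightarrow> a \<preceq> b"
  by (simp add: left_le_def inv_mult_group m_assoc)

lemma left_le_mult_D_iff:
  assumes "a \<in> carrier G" "b \<in> carrier G" shows "a \<otimes> D k \<preceq> b \<otimes> D k \<longleftrightarrow> a \<preceq> b"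
  using conj_D_P_iff[of "inv a \<otimes> b" k] assms by (simp add: left_le_def D_simps)

lemma left_le_mult_P: "a \<in> carrier G \<Longrightarrow> c \<in> P \<Longrightarrow> a \<preceq> a \<otimes> c"
  by (simp add: left_le_def)

lemma right_le_refl [simp]: "a \<in> carrier G \<Longrightarrow> a \<lesssim> a"
  by (simp add: right_le_def)

lemma right_le_trans [trans]:
  assumes "a \<lesssim> b" "b \<lesssim> c" "a \<in> carrier G" "b \<in> carrier G" "c \<in> carrier G" shows "a \<lesssim> c"
proof -
  have "c \<otimes> inv a = (c \<otimes> inv b) \<otimes> (b \<otimes> inv a)"
    using assms by (simp add: m_assoc)
  then show ?thesis using assms by (simp add: right_le_def)
qed

lemma right_le_antisym:
  assumes "a \<lesssim> b" "b \<lesssim> a" "a \<in> carrier G" "b \<in> carrier G" shows "a = b"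
proof -
  have "b \<otimes> inv a = \<one>"
    using assms inv_in_P_imp_one[of "b \<otimes> inv a"] by (simp add: right_le_def inv_mult_group)
  then show ?thesis
    using assms by (metis inv_closed inv_equality inv_inv)
qed

lemma one_right_le_iff: "a \<in> carrier G \<Longrightarrow> \<one> \<lesssim> a \<longleftrightarrow> a \<in> P"
  by (simp add: right_le_def)

lemma right_le_mult_right_iff:
  "a \<in> carrier G \<Longrightarrow> b \<in> carrier G \<Longrightarrow> c \<in> carrier G \<Longrightarrow> a \<otimes> c \<lesssim> b \<otimes> c \<longleftrightarrow> a \<lesssim> b"
  by (simp add: right_le_def inv_mult_group m_assoc)

lemma right_le_D_mult_iff:
  assumes "a \<in> carrier G" "b \<in> carrier G" shows "D k \<otimes> a \<lesssim> D k \<otimes> b \<longleftrightarrow> a \<lesssim> b"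
  using conj_D_P_iff[of "b \<otimes> inv a" "- k"] assms by (simp add: right_le_def D_simps)

lemma right_le_mult_P: "a \<in> carrier G \<Longrightarrow> c \<in> P \<Longrightarrow> a \<lesssim> c \<otimes> a"
  by (simp add: right_le_def m_assoc)

text \<open>For a right lcm \<open>e\<close> of \<open>a\<close> and \<open>b\<close>, the element
  \<open>inv a \<otimes> b\<close> is the quotient of \<open>inv a \<otimes> e\<close> by
  \<open>inv b \<otimes> e\<close>.\<close>

lemma ex_right_fraction:
  assumes "g \<in> carrier G" shows "\<exists>c\<in>P. \<exists>d\<in>P. g = c \<otimes> inv d"
proof -
  obtain a b where ab: "a \<in> P" "b \<in> P" "g = inv a \<otimes> b"
    using fractions[OF assms] by auto
  obtain e where "e \<in> P" "e lcmof\<^bsub>Gpos\<^esub> a b"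
    using Gpos.ex_right_lcm[of a b] ab by auto
  then have e: "e \<in> P" "a \<preceq> e" "b \<preceq> e"
    using ab by (auto simp: islcm_def divides_Gpos_iff)
  have "g = (inv a \<otimes> e) \<otimes> inv (inv b \<otimes> e)"
    using ab e(1) by (simp add: m_assoc inv_mult_group)
  then show ?thesis
    using e unfolding left_le_def by blast
qed

text \<open>Right multiplication by \<open>inv h \<otimes> d\<close> preserves the order and carries
  \<open>g\<close> and \<open>h\<close> to the positive elements \<open>c\<close> and
  \<open>d\<close>. Their left lcm is then translated back.\<close>

lemma ex_right_join:
  assumes g: "g \<in> carrier G" and h: "h \<in> carrier G"
  obtains j where "j \<in> carrier G" "g \<lesssim> j" "h \<lesssim> j"
    "\<And>d. d \<in> carrier G \<Longrightarrow> g \<lesssim> d \<Longrightarrow> h \<lesssim> d \<Longrightarrow> j \<lesssim> d"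
proof -
  obtain c d where cd: "c \<in> P" "d \<in> P" "g \<otimes> inv h = c \<otimes> inv d"
    using ex_right_fraction[of "g \<otimes> inv h"] g h by auto
  have g_eq: "g = c \<otimes> inv d \<otimes> h"
    using cd g h by (metis P_closed inv_solve_right inv_closed m_closed)
  obtain m where "is_left_lcm Gpos {c, d} m"
    using Gpos.ex_left_lcm[of c d] cd by auto
  then have m: "m \<in> P" "c \<lesssim> m" "d \<lesssim> m" "\<And>e. e \<in> P \<Longrightarrow> c \<lesssim> e \<Longrightarrow> d \<lesssim> e \<Longrightarrow> m \<lesssim> e"
    using cd by (auto simp: is_left_lcm_def right_divides_Gpos_iff)
  show thesis
  proof
    show "m \<otimes> inv d \<otimes> h \<in> carrier G" "g \<lesssim> m \<otimes> inv d \<otimes> h" "h \<lesssim> m \<otimes> inv d \<otimes> h"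
      using cd(1,2) h m(1-3) unfolding g_eq right_le_def by (simp_all add: m_assoc inv_mult_group)
    fix e assume e: "e \<in> carrier G" "g \<lesssim> e" "h \<lesssim> e"
    define f where "f = e \<otimes> inv h \<otimes> d"
    have f: "c \<lesssim> f" "d \<lesssim> f" "f \<in> carrier G"
      using e cd(1,2) h unfolding g_eq right_le_def f_def by (simp_all add: m_assoc inv_mult_group)
    have "(e \<otimes> inv h) \<otimes> d \<in> P"
      using e(3) cd(2) unfolding right_le_def by (rule mult_in_P)
    then have "m \<lesssim> f"
      using f m(4) by (simp add: f_def)
    then show "m \<otimes> inv d \<otimes> h \<lesssim> e"
      using e(1) cd(1,2) h m(1) unfolding right_le_def f_def by (simp add: m_assoc inv_mult_group)
  qed
qed

text \<open>Left multiplication by \<open>a\<close> turns \<open>w\<close> and \<open>\<one>\<close>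
  into \<open>b\<close> and \<open>a\<close>, whose right lcm exists in the monoid.\<close>

lemma ex_left_join_one:
  assumes w: "w \<in> carrier G"
  obtains v where "v \<in> P" "w \<preceq> v" "\<And>d. d \<in> P \<Longrightarrow> w \<preceq> d \<Longrightarrow> v \<preceq> d"
proof -
  obtain a b where ab: "a \<in> P" "b \<in> P" "w = inv a \<otimes> b"
    using fractions[OF assms] by auto
  obtain c where "c \<in> P" "c lcmof\<^bsub>Gpos\<^esub> a b"
    using Gpos.ex_right_lcm[of a b] ab by auto
  then have c: "c \<in> P" "a \<preceq> c" "b \<preceq> c" "\<And>e. e \<in> P \<Longrightarrow> a \<preceq> e \<Longrightarrow> b \<preceq> e \<Longrightarrow> c \<preceq> e"
    using ab by (auto simp: islcm_def divides_Gpos_iff)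
  show thesis
  proof
    show "inv a \<otimes> c \<in> P" "w \<preceq> inv a \<otimes> c"
      using ab c(1-3) by (simp_all add: left_le_def m_assoc inv_mult_group)
    fix d assume d: "d \<in> P" "w \<preceq> d"
    then have "c \<preceq> a \<otimes> d"
      using ab by (intro c(4)) (simp_all add: left_le_def m_assoc inv_mult_group)
    then show "inv a \<otimes> c \<preceq> d"
      using ab(1) c(1) d(1) by (simp add: left_le_def m_assoc inv_mult_group)
  qed
qed

section \<open>Greatest common left divisors with \<Delta>\<close>

definition head :: "'a \<Rightarrow> 'a" where
  "head x = somegcd Gpos \<Delta> x"

text \<open>A gcd arises as the right lcm of the finitely many simple elements that left divide
  \<open>x\<close>: \<Delta> and \<open>x\<close> are common multiples of these, so the lcm divides
  both.\<close>

lemma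
  assumes x: "x \<in> P"
  shows head_in_S: "head x \<in> S" and head_left_le: "head x \<preceq> x"
    and left_le_head: "w \<in> carrier G \<Longrightarrow> w \<preceq> \<Delta> \<Longrightarrow> w \<preceq> x \<Longrightarrow> w \<preceq> head x"
proof -
  define U where "U = {s \<in> S. s \<preceq> x}"
  have "finite U" "U \<subseteq> U"
    using simples_finite by (auto simp: U_def)
  then have "\<exists>c\<in>P. (\<forall>s\<in>U. s \<preceq> c) \<and> c \<preceq> \<Delta> \<and> c \<preceq> x"
  proof (induction rule: finite_subset_induct')
    case empty
    then show ?case
      using x by (intro bexI[of _ \<one>]) (auto simp: left_le_def)
  next
    case (insert s F)
    then obtain c where c: "c \<in> P" "\<forall>s\<in>F. s \<preceq> c" "c \<preceq> \<Delta>" "c \<preceq> x"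
      by blast
    have s: "s \<in> P" "s \<preceq> \<Delta>" "s \<preceq> x"
      using insert S_iff_left by (auto simp: U_def left_le_def)
    obtain e where "e \<in> P" "e lcmof\<^bsub>Gpos\<^esub> s c"
      using Gpos.ex_right_lcm[of s c] s c by auto
    then have e: "e \<in> P" "s \<preceq> e" "c \<preceq> e" "\<And>f. f \<in> P \<Longrightarrow> s \<preceq> f \<Longrightarrow> c \<preceq> f \<Longrightarrow> e \<preceq> f"
      using s c by (auto simp: islcm_def divides_Gpos_iff)
    have "t \<preceq> e" if "t \<in> F" for t
      using that insert left_le_trans[of t c e] c e S_subset_P by (auto simp: U_def)
    then show ?case
      using e s c x by (intro bexI[of _ e]) auto
  qed
  then obtain c where c: "c \<in> P" "\<forall>s\<in>U. s \<preceq> c" "c \<preceq> \<Delta>" "c \<preceq> x"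
    by blast
  have gcd: "d gcdof\<^bsub>Gpos\<^esub> \<Delta> x \<longleftrightarrow> d \<preceq> \<Delta> \<and> d \<preceq> x \<and> (\<forall>s\<in>U. s \<preceq> d)" if "d \<in> P" for d
    using that x S_iff_left by (auto simp: isgcd_def divides_Gpos_iff U_def left_le_def)
  have "head x \<in> P \<and> head x gcdof\<^bsub>Gpos\<^esub> \<Delta> x"
    unfolding head_def somegcd_def Gpos_simps
    by (rule someI[of _ c]) (use c gcd in auto)
  then have *: "head x \<in> P" "head x \<preceq> \<Delta>" "head x \<preceq> x" "\<And>s. s \<in> U \<Longrightarrow> s \<preceq> head x"
    using gcd by auto
  then show "head x \<in> S" "head x \<preceq> x"
    using S_iff_left by (auto simp: left_le_def)
  assume w: "w \<in> carrier G" "w \<preceq> \<Delta>" "w \<preceq> x"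
  \<comment> \<open>\<open>w\<close> need not be positive, but its join \<open>v\<close> with
    \<open>\<one>\<close> is still below \<Delta> and \<open>x\<close>, hence lies in
    \<open>U\<close>.\<close>
  obtain v where v: "v \<in> P" "w \<preceq> v" "\<And>d. d \<in> P \<Longrightarrow> w \<preceq> d \<Longrightarrow> v \<preceq> d"
    using ex_left_join_one[OF w(1)] by blast
  have "v \<in> U"
    using v w x S_iff_left by (simp add: U_def left_le_def)
  then show "w \<preceq> head x"
    using * v left_le_trans[of w v "head x"] w by simp
qed


section \<open>Infimum, supremum and normal form\<close>

text \<open>Powers of \<Delta> normalize \<open>P\<close>, so the left factor \<open>c\<close> can
  be moved to the right; the two-sided order becomes one-sided divisibility.\<close>

lemma sub_le_D_left_iff:
  assumes "a \<in> carrier G" shows "sub_le (D m) a \<longleftrightarrow> D (- m) \<otimes> a \<in> P"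
proof
  assume "sub_le (D m) a"
  then obtain c c' where c: "c \<in> P" "c' \<in> P" "a = c \<otimes> D m \<otimes> c'"
    unfolding sub_le_def by auto
  then have "D (- m) \<otimes> a = (D (- m) \<otimes> c \<otimes> D m) \<otimes> c'"
    by (simp add: m_assoc)
  then show "D (- m) \<otimes> a \<in> P"
    using c conj_D_P[of c m] by simp
next
  assume "D (- m) \<otimes> a \<in> P"
  then show "sub_le (D m) a"
    using assms unfolding sub_le_def
    by (intro bexI[of _ \<one>] bexI[of _ "D (- m) \<otimes> a"]) (simp_all add: D_simps)
qed

lemma sub_le_D_right_iff:
  assumes "a \<in> carrier G" shows "sub_le a (D n) \<longleftrightarrow> inv a \<otimes> D n \<in> P"
proof
  assume "sub_le a (D n)"
  then obtain c c' where c: "c \<in> P" "c' \<in> P" "D n = c \<otimes> a \<otimes> c'"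
    unfolding sub_le_def by auto
  have "inv a \<otimes> D n = c' \<otimes> (D (- n) \<otimes> c \<otimes> D n)"
    using c(1,2) assms unfolding inv_D[symmetric] c(3) by (simp add: m_assoc inv_mult_group)
  then show "inv a \<otimes> D n \<in> P"
    using c conj_D_P[of c n] by simp
next
  assume "inv a \<otimes> D n \<in> P"
  then show "sub_le a (D n)"
    using assms unfolding sub_le_def
    by (intro bexI[of _ \<one>] bexI[of _ "inv a \<otimes> D n"]) (simp_all add: m_assoc)
qed

lemma D_in_P_imp_nonneg: "\<Delta> \<noteq> \<one> \<Longrightarrow> D k \<in> P \<Longrightarrow> 0 \<le> k"
  using D_not_in_P by force

text \<open>Some power of \<Delta> lies below \<open>a\<close> and some power above it. As negative
  powers of a nontrivial \<Delta> are not positive, the admissible exponents are bounded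
  above.\<close>

lemma g_inf_ge_iff:
  assumes "\<Delta> \<noteq> \<one>" "a \<in> carrier G"
  shows "m \<le> g_inf a \<longleftrightarrow> D (- m) \<otimes> a \<in> P"
proof -
  obtain j where j: "D j \<otimes> a \<in> P"
    using ex_D_mult_in_P assms by blast
  obtain k where k: "D k \<otimes> inv a \<in> P"
    using ex_D_mult_in_P[of "inv a"] assms by auto
  have "m \<le> (GREATEST x. sub_le (D x) a) \<longleftrightarrow> sub_le (D m) a"
  proof (rule int_le_Greatest_iff[of _ "- j" k])
    show "sub_le (D (- j)) a"
      using j assms sub_le_D_left_iff by simp
  next
    fix m assume *: "sub_le (D m) a"
    have "(D (- m) \<otimes> a) \<otimes> (inv a \<otimes> D k) \<in> P"
      by (rule mult_in_P) (use * k assms sub_le_D_left_iff D_commute_P_iff in auto)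
    then show "m \<le> k"
      using D_in_P_imp_nonneg[of "k - m"] assms by (simp add: D_simps)
  next
    fix m n assume *: "sub_le (D m) a" "n \<le> m"
    have "D (m - n) \<otimes> (D (- m) \<otimes> a) \<in> P"
      by (rule mult_in_P) (use * assms sub_le_D_left_iff D_in_P[of "m - n"] in auto)
    then show "sub_le (D n) a"
      using assms sub_le_D_left_iff by (simp add: D_simps)
  qed
  then show ?thesis
    using assms sub_le_D_left_iff unfolding g_inf_def by simp
qed

lemma g_sup_le_iff:
  assumes "\<Delta> \<noteq> \<one>" "a \<in> carrier G"
  shows "g_sup a \<le> n \<longleftrightarrow> inv a \<otimes> D n \<in> P"
proof -
  obtain j where j: "D j \<otimes> a \<in> P"
    using ex_D_mult_in_P assms by blast
  obtain k where k: "D k \<otimes> inv a \<in> P"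
    using ex_D_mult_in_P[of "inv a"] assms by auto
  have "(LEAST x. sub_le a (D x)) \<le> n \<longleftrightarrow> sub_le a (D n)"
  proof (rule int_Least_le_iff[of _ k "- j"])
    show "sub_le a (D k)"
      using k assms sub_le_D_right_iff D_commute_P_iff by simp
  next
    fix m assume *: "sub_le a (D m)"
    have "(D j \<otimes> a) \<otimes> (inv a \<otimes> D m) \<in> P"
      by (rule mult_in_P) (use * j assms sub_le_D_right_iff in auto)
    then show "- j \<le> m"
      using D_in_P_imp_nonneg[of "j + m"] assms by (simp add: D_simps)
  next
    fix m n assume *: "sub_le a (D m)" "m \<le> n"
    have "(inv a \<otimes> D m) \<otimes> D (n - m) \<in> P"
      by (rule mult_in_P) (use * assms sub_le_D_right_iff D_in_P[of "n - m"] in auto)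
    then show "sub_le a (D n)"
      using assms sub_le_D_right_iff by (simp add: D_simps)
  qed
  then show ?thesis
    using assms sub_le_D_right_iff unfolding g_sup_def by simp
qed

section \<open>Normal forms of positive elements\<close>

lemma list_product_in_P: "set xs \<subseteq> P \<Longrightarrow> list_product G xs \<in> P"
  by (induction xs) auto

lemma list_product_eq_one:
  "set xs \<subseteq> P \<Longrightarrow> list_product G xs = \<one> \<Longrightarrow> x \<in> set xs \<Longrightarrow> x = \<one>"
proof (induction xs)
  case (Cons y ys)
  then have "y = \<one>"
    using Gpos.mult_eq_one[of y "list_product G ys"] list_product_in_P by simp
  then show ?case
    using Cons list_product_in_P by auto
qed simp

lemma head_one: "head \<one> = \<one>"
  using inv_in_P_imp_one[of "head \<one>"] head_in_S[of \<one>] head_left_le[of \<one>] S_subset_P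
  by (auto simp: left_le_def)

text \<open>A nontrivial product of simple elements is left divisible by a nontrivial simple
  element, which must then divide the head.\<close>

lemma head_ne_one:
  assumes "x \<in> P" "x \<noteq> \<one>" shows "head x \<noteq> \<one>"
proof
  assume h: "head x = \<one>"
  have "x = \<one> \<or> (\<exists>s\<in>S. s \<noteq> \<one> \<and> s \<preceq> x)"
    using assms(1) unfolding P_eq
  proof (induction rule: submonoid_generate.induct)
    case (incl s)
    then show ?case
      using simples_carrier left_le_refl[of s] by blast
  next
    case (mult a b)
    then have "a \<in> P" "b \<in> P"
      by (simp_all add: P_eq)
    then show ?case
      using mult.IH left_le_trans[OF _ left_le_mult_P[of a b]] simples_carrier
      by (cases "a = \<one>") (simp, metis P_closed m_closed subsetD)
  qed simp
  then obtain s where s: "s \<in> S" "s \<noteq> \<one>" "s \<preceq> x"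
    using assms by blast
  then have "s \<preceq> \<one>"
    using left_le_head[OF assms(1), of s] S_iff_left h by (auto simp: left_le_def)
  then show False
    using s inv_in_P_imp_one[of s] S_subset_P by (auto simp: left_le_def)
qed

text \<open>The conditions of \<open>is_normal_form\<close> apart from the power of \<Delta>, in a
  shape that allows the first factor to be peeled off.\<close>

definition normal_list :: "'a list \<Rightarrow> bool" where
  "normal_list ss \<longleftrightarrow> set ss \<subseteq> S \<and>
     (\<forall>j<length ss. ss ! j = head (list_product G (drop j ss))) \<and> (ss \<noteq> [] \<longrightarrow> last ss \<noteq> \<one>)"

lemma normal_list_Nil [simp]: "normal_list []"
  by (simp add: normal_list_def)

lemma normal_list_Cons:
  "normal_list (s # ss) \<longleftrightarrow>
     s \<in> S \<and> s = head (s \<otimes> list_product G ss) \<and> normal_list ss \<and> (ss = [] \<longrightarrow> s \<noteq> \<one>)"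
  by (auto simp: normal_list_def All_less_Suc2)

lemma normal_list_eq_Nil:
  assumes "normal_list ss" "list_product G ss = \<one>" shows "ss = []"
  using assms S_subset_P by (meson list_product_eq_one last_in_set normal_list_def order_trans)

lemma normal_list_unique:
  "normal_list ss \<Longrightarrow> normal_list ts \<Longrightarrow> list_product G ss = list_product G ts \<Longrightarrow> ss = ts"
proof (induction ss arbitrary: ts)
  case Nil
  then show ?case
    using normal_list_eq_Nil[of ts] by simp
next
  case (Cons s ss)
  show ?case
  proof (cases ts)
    case Nil
    then show ?thesis
      using Cons normal_list_eq_Nil[of "s # ss"] by simp
  next
    case ts: (Cons t us)
    have "s = t"
      using Cons.prems unfolding ts normal_list_Cons by simp
    moreover have "set ss \<subseteq> carrier G" "set us \<subseteq> carrier G" "s \<in> carrier G"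
      using Cons.prems simples_carrier unfolding ts normal_list_def by auto
    ultimately have "list_product G ss = list_product G us"
      using Cons.prems by (simp add: ts)
    then show ?thesis
      using Cons ts \<open>s = t\<close> by (simp add: normal_list_Cons)
  qed
qed

text \<open>Heads are peeled off one after another. The induction is on a bound for the lengths of
  factorizations into nonidentity elements, which each nontrivial head lowers by one.\<close>

lemma ex_normal_list:
  assumes "x \<in> P" shows "\<exists>ss. normal_list ss \<and> list_product G ss = x"
proof -
  have "\<exists>ss. normal_list ss \<and> list_product G ss = x"
    if "x \<in> P" "\<And>xs. set xs \<subseteq> P - {\<one>} \<Longrightarrow> list_product G xs = x \<Longrightarrow> length xs \<le> n" for n x
    using that
  proof (induction n arbitrary: x)
    case 0
    then have "x = \<one>"
      using "0.prems"(2)[of "[x]"] by auto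
    then show ?case
      by (intro exI[of _ "[]"]) simp
  next
    case (Suc n)
    show ?case
    proof (cases "x = \<one>")
      case True
      then show ?thesis
        by (intro exI[of _ "[]"]) simp
    next
      case False
      define y where "y = inv (head x) \<otimes> x"
      have h: "head x \<in> S" "head x \<in> P" "head x \<noteq> \<one>" and y: "y \<in> P"
        using head_in_S head_ne_one head_left_le S_subset_P False Suc.prems(1)
        by (auto simp: y_def left_le_def)
      then have x: "x = head x \<otimes> y"
        using Suc.prems(1) by (simp add: y_def)
      have "length xs \<le> n" if "set xs \<subseteq> P - {\<one>}" "list_product G xs = y" for xs
        using Suc.prems(2)[of "head x # xs"] that h x by auto
      then obtain ss where "normal_list ss" "list_product G ss = y"
        using Suc.IH[OF y] by blast
      then show ?thesis
        using h x by (intro exI[of _ "head x # ss"]) (simp add: normal_list_Cons)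
    qed
  qed
  moreover obtain n where
    "\<And>xs. set xs \<subseteq> P - {\<one>} \<Longrightarrow> list_product G xs = x \<Longrightarrow> length xs \<le> n"
    using Gpos.noetherian_bound[of x] assms by (auto simp: list_product_Gpos)
  ultimately show ?thesis
    using assms by blast
qed

lemma normal_form:
  assumes "\<Delta> \<noteq> \<one>" "a \<in> carrier G"
  shows "normal_list (normal_form a)" "list_product G (normal_form a) = D (- g_inf a) \<otimes> a"
proof -
  have "D (- g_inf a) \<otimes> a \<in> P"
    using g_inf_ge_iff[OF assms, of "g_inf a"] by simp
  then have "\<exists>!ss. normal_list ss \<and> list_product G ss = D (- g_inf a) \<otimes> a"
    using ex_normal_list normal_list_unique by (metis (no_types))
  moreover have iff: "is_normal_form a ss \<longleftrightarrow> normal_list ss \<and> list_product G ss = D (- g_inf a) \<otimes> a" for ss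
  proof -
    have "a = D (g_inf a) \<otimes> list_product G ss \<longleftrightarrow> list_product G ss = D (- g_inf a) \<otimes> a"
      if "set ss \<subseteq> S"
      using that assms(2) simples_carrier inv_solve_left[of "list_product G ss" "D (g_inf a)" a]
      by (auto simp: inv_D)
    then show ?thesis
      by (auto simp: is_normal_form_def normal_list_def head_def)
  qed
  ultimately have "\<exists>!ss. is_normal_form a ss"
    by simp
  then have "is_normal_form a (normal_form a)"
    unfolding normal_form_def by (rule theI')
  then show "normal_list (normal_form a)" "list_product G (normal_form a) = D (- g_inf a) \<otimes> a"
    unfolding iff by auto
qed

lemma first_factor_eq_head:
  assumes "\<Delta> \<noteq> \<one>" "a \<in> carrier G" shows "first_factor a = head (D (- g_inf a) \<otimes> a)"
  using normal_form[OF assms] head_one unfolding first_factor_def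
  by (cases "normal_form a") (auto simp: normal_list_Cons)

text \<open>The first \<open>k\<close> factors multiply to the gcd of \<open>D (int k)\<close> and
  the whole product; this is the half of that fact that rests on normality. The element
  \<open>u\<close> need not be positive.\<close>

lemma left_le_take:
  "normal_list ss \<Longrightarrow> u \<in> carrier G \<Longrightarrow> u \<preceq> list_product G ss \<Longrightarrow> u \<preceq> D (int k) \<Longrightarrow>
    u \<preceq> list_product G (take k ss)"
proof (induction k arbitrary: u ss)
  case (Suc k)
  show ?case
  proof (cases ss)
    case Nil
    then show ?thesis using Suc.prems by simp
  next
    case (Cons s ts)
    have s: "s \<in> S" "s \<in> carrier G" and ts: "normal_list ts" "set ts \<subseteq> P"
      and s_head: "s = head (list_product G ss)"
      using Suc.prems(1) S_subset_P simples_carrier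
      unfolding Cons normal_list_Cons by (auto simp: normal_list_def)
    have x: "list_product G ss \<in> P" "list_product G ts \<in> P"
      using list_product_in_P[OF ts(2)] s(1) S_subset_P unfolding Cons by auto
    \<comment> \<open>Removing \<open>k\<close> factors \<Delta> from \<open>u\<close> leaves an
      element below both \<Delta> and the product, hence below the first factor \<open>s\<close>.
      Dividing \<open>u\<close> by \<open>s\<close> then leads back to exponent
      \<open>k\<close>.\<close>
    define w where "w = u \<otimes> D (- int k)"
    have w: "w \<in> carrier G" "u = w \<otimes> D (int k)"
      using Suc.prems(2) by (simp_all add: w_def D_simps)
    have "w \<preceq> u"
      unfolding w(2) using w(1) D_in_P by (intro left_le_mult_P) auto
    then have "w \<preceq> list_product G ss"
      using left_le_trans[of w u] Suc.prems(2,3) w(1) x by simp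
    moreover have "w \<otimes> D (int k) \<preceq> D 1 \<otimes> D (int k)"
      using Suc.prems(4) unfolding w(2)[symmetric] D_mult by simp
    then have "w \<preceq> \<Delta>"
      using w(1) left_le_mult_D_iff unfolding D_1 by simp
    ultimately have "w \<preceq> s"
      unfolding s_head using left_le_head x(1) w(1) by simp
    then have "u \<preceq> s \<otimes> D (int k)"
      using w s left_le_mult_D_iff by simp
    then have "inv s \<otimes> u \<preceq> D (int k)"
      using left_le_mult_left_iff[of "inv s \<otimes> u" "D (int k)" s] s Suc.prems(2) by simp
    moreover have "inv s \<otimes> u \<preceq> list_product G ts"
      using left_le_mult_left_iff[of "inv s \<otimes> u" "list_product G ts" s] s Suc.prems(2,3) x
      by (simp add: Cons)
    ultimately have "inv s \<otimes> u \<preceq> list_product G (take k ts)"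
      using Suc.IH ts s Suc.prems(2) by simp
    moreover have "list_product G (take k ts) \<in> carrier G"
      using ts(2) by (intro list_product_closed) (auto dest: in_set_takeD)
    ultimately show ?thesis
      using left_le_mult_left_iff[of "inv s \<otimes> u" "list_product G (take k ts)" s] s Suc.prems(2)
      by (simp add: Cons)
  qed
qed simp

lemma list_product_left_le_D:
  "set ss \<subseteq> S \<Longrightarrow> list_product G ss \<preceq> D (int (length ss))"
proof (induction ss)
  case (Cons s ss)
  then have s: "s \<in> P" "inv s \<otimes> \<Delta> \<in> P" and ss: "set ss \<subseteq> P"
    using S_iff_left S_subset_P by auto
  define x where "x = list_product G ss"
  have x: "x \<in> P" "inv x \<otimes> D (int (length ss)) \<in> P"
    using ss list_product_in_P Cons by (auto simp: x_def left_le_def)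
  have "inv (s \<otimes> x) \<otimes> D (int (length (s # ss))) = (inv x \<otimes> D (int (length ss))) \<otimes>
    (D (- int (length ss)) \<otimes> (inv s \<otimes> D 1) \<otimes> D (int (length ss)))"
    using s x by (simp add: D_simps del: int_pow_1)
  also have "\<dots> \<in> P"
    using mult_in_P[OF x(2) conj_D_P[OF s(2), of "int (length ss)"]] unfolding D_1 .
  finally show ?case
    by (simp add: left_le_def x_def)
qed simp


section \<open>The sliding element\<close>

lemma compl_inv_first_factor_in_P:
  assumes "\<Delta> \<noteq> \<one>" "b \<in> carrier G"
  shows "tau_pow k (compl_inv (first_factor b)) \<in> P"
proof -
  have "first_factor b \<in> S"
    unfolding first_factor_eq_head[OF assms]
    using assms g_inf_ge_iff[of b "g_inf b"] by (intro head_in_S) simp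
  then have "\<Delta> \<otimes> inv (first_factor b) \<in> P"
    using S_iff_right by blast
  then show ?thesis
    unfolding tau_pow_def compl_inv_def inv_D by (rule conj_D_P)
qed

text \<open>
  With \<open>e\<close> the conjugate of \<open>d\<close> by a power of \<open>\<Delta>\<close> and \<open>A\<close> the positive part of \<open>b\<close>, the right-hand side
  says \<open>e\<^sup>-\<^sup>1 \<Delta> \<preceq> A\<close>; as \<open>e\<^sup>-\<^sup>1 \<Delta> \<preceq> \<Delta>\<close> always holds, \<open>A\<close> may be replaced by \<open>\<Delta> \<and> A\<close>.
\<close>

lemma first_factor_right_le_iff:
  assumes "\<Delta> \<noteq> \<one>" "b \<in> carrier G" "d \<in> P" "p = g_inf b + 1"
  shows "tau_pow (- p + 1) (compl_inv (first_factor b)) \<lesssim> d \<longleftrightarrow> D p \<otimes> inv b \<lesssim> d"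
proof -
  define A where "A = D (1 - p) \<otimes> b"
  have A: "A \<in> P" "first_factor b = head A"
    using assms g_inf_ge_iff[of b "g_inf b"] first_factor_eq_head by (simp_all add: A_def)
  then have s: "head A \<in> S" "head A \<in> P"
    using head_in_S S_subset_P by auto
  define e where "e = D (- (p - 1)) \<otimes> d \<otimes> D (p - 1)"
  have e: "e \<in> P"
    unfolding e_def using assms(3) by (rule conj_D_P)
  have compl: "compl_inv (head A) = D 1 \<otimes> inv (head A)"
    by (simp add: compl_inv_def)
  have "tau_pow (- p + 1) (compl_inv (first_factor b)) \<lesssim> d \<longleftrightarrow> d \<otimes> D (p - 1) \<otimes> head A \<otimes> D (- p) \<in> P"
    using s assms unfolding right_le_def tau_pow_def A(2) compl
    by (simp add: D_simps del: int_pow_1)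
  also have "\<dots> \<longleftrightarrow> inv e \<otimes> D 1 \<preceq> head A"
    using s assms e D_commute_P_iff[of "d \<otimes> D (p - 1) \<otimes> head A" "- p"]
    unfolding left_le_def e_def by (simp add: D_simps del: int_pow_1)
  also have "\<dots> \<longleftrightarrow> inv e \<otimes> D 1 \<preceq> A"
  proof
    assume "inv e \<otimes> D 1 \<preceq> head A"
    then show "inv e \<otimes> D 1 \<preceq> A"
      using left_le_trans[OF _ head_left_le[OF A(1)]] s e A by simp
  next
    assume *: "inv e \<otimes> D 1 \<preceq> A"
    have "inv e \<otimes> D 1 \<preceq> \<Delta>"
      using conj_D_P[OF e, of 1] e by (simp add: left_le_def inv_mult_group m_assoc int_pow_neg)
    with * show "inv e \<otimes> D 1 \<preceq> head A"
      using left_le_head A e by simp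
  qed
  also have "\<dots> \<longleftrightarrow> d \<otimes> b \<otimes> D (- p) \<in> P"
    using assms e D_commute_P_iff[of "d \<otimes> b" "- p"]
    unfolding left_le_def e_def A_def by (simp add: D_simps del: int_pow_1)
  also have "\<dots> \<longleftrightarrow> D p \<otimes> inv b \<lesssim> d"
    using assms by (simp add: right_le_def D_simps)
  finally show ?thesis .
qed

lemma normal_form_snoc:
  assumes "\<Delta> \<noteq> \<one>" "b \<in> carrier G" "normal_form b \<noteq> []"
  obtains ss s where "normal_form b = ss @ [s]" "normal_list (ss @ [s])" "set ss \<subseteq> S" "s \<in> S" "s \<noteq> \<one>"
    "D (- g_inf b) \<otimes> b = list_product G ss \<otimes> s" "last_factor b = s"
proof -
  obtain ss s where nf: "normal_form b = ss @ [s]"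
    using assms(3) by (metis rev_exhaust)
  have "normal_list (ss @ [s])" "list_product G (ss @ [s]) = D (- g_inf b) \<otimes> b"
    using normal_form[OF assms(1,2)] by (simp_all add: nf)
  moreover from this have "set ss \<subseteq> S" "s \<in> S" "s \<noteq> \<one>"
    by (auto simp: normal_list_def)
  moreover from this have "set ss \<subseteq> carrier G" "s \<in> carrier G"
    using simples_carrier by auto
  ultimately show thesis
    using that[of ss s] nf by (simp add: list_product_append last_factor_def)
qed

text \<open>A product of \<open>l\<close> simple elements divides \<open>D l\<close>. If it divided
  \<open>D (l - 1)\<close>, then by \<open>left_le_take\<close> it would divide the product of all
  factors but the last, and the inverse of the last factor would be positive.\<close>

lemma g_sup_eq:
  assumes "\<Delta> \<noteq> \<one>" "b \<in> carrier G"
  shows "g_sup b = g_inf b + int (length (normal_form b))"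
proof -
  let ?x = "list_product G (normal_form b)"
  have x: "?x = D (- g_inf b) \<otimes> b"
    using normal_form assms by simp
  have iff: "g_sup b \<le> g_inf b + n \<longleftrightarrow> ?x \<preceq> D n" for n
    unfolding g_sup_le_iff[OF assms] x left_le_def using assms(2) by (simp add: D_simps)
  have "?x \<preceq> D (int (length (normal_form b)))"
    using normal_form[OF assms] by (intro list_product_left_le_D) (simp add: normal_list_def)
  moreover have "\<not> ?x \<preceq> D (int (length (normal_form b)) - 1)"
  proof
    assume *: "?x \<preceq> D (int (length (normal_form b)) - 1)"
    show False
    proof (cases "normal_form b = []")
      case True
      then have "D (- 1) \<in> P"
        using * by (simp add: left_le_def)
      then show False
        using D_not_in_P assms(1) by force
    next
      case False
      then obtain ss s where nf: "normal_form b = ss @ [s]" "normal_list (ss @ [s])"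
        "set ss \<subseteq> S" "s \<in> S" "s \<noteq> \<one>" "D (- g_inf b) \<otimes> b = list_product G ss \<otimes> s"
        using normal_form_snoc[OF assms] by metis
      have ss: "list_product G ss \<in> carrier G" "s \<in> carrier G"
        using nf(3,4) simples_carrier by (auto intro!: list_product_closed)
      have "?x \<preceq> list_product G (take (length ss) (ss @ [s]))"
        using * nf x ss by (intro left_le_take) simp_all
      then have "inv s \<in> P"
        using ss nf(4) simples_carrier unfolding x nf(6) left_le_def
        by (auto simp: inv_mult_group m_assoc)
      then show False
        using inv_in_P_imp_one nf S_subset_P by blast
    qed
  qed
  ultimately show ?thesis
    using iff[of "int (length (normal_form b))"] iff[of "int (length (normal_form b)) - 1"] by simp
qed

lemma last_factor_right_le_iff:
  assumes "\<Delta> \<noteq> \<one>" "b \<in> carrier G" "d \<in> P" "normal_form b \<noteq> []" "q = g_sup b - 1"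
  shows "last_factor b \<lesssim> d \<longleftrightarrow> D (- q) \<otimes> b \<lesssim> d"
proof -
  obtain ss s where nf: "normal_form b = ss @ [s]" "normal_list (ss @ [s])"
    "set ss \<subseteq> S" "s \<in> S" "s \<noteq> \<one>" "D (- g_inf b) \<otimes> b = list_product G ss \<otimes> s" "last_factor b = s"
    using normal_form_snoc[OF assms(1,2,4)] by metis
  define B where "B = list_product G ss"
  define k where "k = int (length ss)"
  have B: "B \<in> P" and s: "s \<in> P"
    using nf(3,4) S_subset_P list_product_in_P unfolding B_def by auto
  have q: "q = g_inf b + k"
    using g_sup_eq[OF assms(1,2)] nf(1) assms(5) by (simp add: k_def)
  have b': "D (- q) \<otimes> b = D (- k) \<otimes> (B \<otimes> s)"
    using B s nf(6) assms(2) D_mult_left[of "b" "- k" "- g_inf b"]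
    unfolding B_def[symmetric] q by (simp add: add.commute)
  have iff: "D (- q) \<otimes> b \<lesssim> d \<longleftrightarrow> d \<otimes> inv s \<otimes> (inv B \<otimes> D k) \<in> P"
    unfolding b' right_le_def using B s assms(3) by (simp add: D_simps)
  have "inv B \<otimes> D k \<in> P"
    using list_product_left_le_D[OF nf(3)] by (simp add: left_le_def B_def k_def)
  moreover have "d \<otimes> inv s \<in> P" if "d \<otimes> inv s \<otimes> (inv B \<otimes> D k) \<in> P"
  proof -
    \<comment> \<open>\<open>u \<preceq> D k\<close> restates the assumption and
      \<open>u \<preceq> B \<otimes> s\<close> the positivity of \<open>d\<close>. Truncation to the
      first \<open>k\<close> factors gives \<open>u \<preceq> B\<close>, which means
      \<open>s \<lesssim> d\<close>.\<close>
    define u where "u = B \<otimes> s \<otimes> inv d"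
    have u: "u \<in> carrier G" "u \<preceq> D k" "u \<preceq> B \<otimes> s"
      using that B s assms(3) by (simp_all add: u_def left_le_def D_simps)
    moreover have "list_product G (ss @ [s]) = B \<otimes> s"
      using normal_form[OF assms(1,2)] nf(1,6) by (simp add: B_def)
    ultimately have "u \<preceq> list_product G (take (length ss) (ss @ [s]))"
      using nf(2) by (intro left_le_take) (simp_all add: k_def)
    then show ?thesis
      using B s assms(3) by (simp add: u_def left_le_def B_def[symmetric] inv_mult_group m_assoc)
  qed
  ultimately show ?thesis
    unfolding iff unfolding nf(7) right_le_def by auto
qed

text \<open>
  An empty normal form with supremum above \<open>q\<close> would make the convention \<open>last_factor b = \<one>\<close> wrong;
  this lemma excludes it whenever the target interval is reachable.
\<close>

lemma conj_D_Suc_not_right_le: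
  assumes "\<Delta> \<noteq> \<one>" "h \<in> carrier G"
  shows "\<not> D (- q) \<otimes> h \<otimes> D (q + 1) \<lesssim> h"
proof
  assume *: "D (- q) \<otimes> h \<otimes> D (q + 1) \<lesssim> h"
  obtain j where j: "D j \<otimes> h \<in> P"
    using ex_D_mult_in_P assms by blast
  obtain k where k: "D k \<otimes> inv h \<in> P"
    using ex_D_mult_in_P[of "inv h"] assms by auto
  \<comment> \<open>The map \<open>g \<mapsto> D (- q) \<otimes> g \<otimes> D (q + 1)\<close>
    preserves the order and raises the exponent of a power of \<Delta> by one. Iterating it puts
    every power of \<Delta> below \<open>h\<close>, although
    \<open>h \<lesssim> D k\<close>.\<close>
  have "D (- j + int n) \<lesssim> h" for n
  proof (induction n)
    case 0
    then show ?case
      using j assms(2) by (simp add: right_le_def inv_D D_commute_P_iff)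
  next
    case (Suc n)
    then have "D (- q) \<otimes> D (- j + int n) \<otimes> D (q + 1) \<lesssim> D (- q) \<otimes> h \<otimes> D (q + 1)"
      using assms(2) by (simp add: right_le_mult_right_iff right_le_D_mult_iff)
    from right_le_trans[OF this *] show ?case
      using assms(2) by (simp add: D_mult algebra_simps)
  qed
  from this[of "nat (k + j + 1)"] have "D (- j + int (nat (k + j + 1))) \<lesssim> h" .
  moreover have "h \<lesssim> D k"
    using k by (simp add: right_le_def)
  ultimately have "D (- j + int (nat (k + j + 1))) \<lesssim> D k"
    using right_le_trans assms(2) D_closed by blast
  then have "D (k + j - int (nat (k + j + 1))) \<in> P"
    by (simp add: right_le_def D_simps algebra_simps)
  then show False
    using D_not_in_P[OF assms(1)] by force
qed

text \<open>
  A pair \<open>(m, c)\<close> encodes the condition \<open>\<Delta>\<^sup>m g c \<lesssim> g\<close> on a conjugating element \<open>g\<close>; this turns lower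
  bounds on infima and upper bounds on suprema into conditions of the same shape.
\<close>

definition bounds :: "nat \<Rightarrow> (nat \<Rightarrow> int) \<Rightarrow> (nat \<Rightarrow> int) \<Rightarrow> (nat \<Rightarrow> 'a) \<Rightarrow> (int \<times> 'a) set" where
  "bounds r p q b = (\<lambda>j. (p j, inv (b j))) ` {1..r} \<union> (\<lambda>j. (- q j, b j)) ` {1..r}"

lemma tuples_carrier: "b \<in> tuples r \<Longrightarrow> j \<in> {1..r} \<Longrightarrow> b j \<in> carrier G"
  by (auto simp: tuples_def)

lemma bounds_carrier: "b \<in> tuples r \<Longrightarrow> (m, c) \<in> bounds r p q b \<Longrightarrow> c \<in> carrier G"
  by (auto simp: bounds_def tuples_carrier)

lemma inf_right_le_iff:
  assumes "\<Delta> \<noteq> \<one>" "b \<in> carrier G" shows "D p \<otimes> inv b \<lesssim> D k \<longleftrightarrow> p - k \<le> g_inf b"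
  unfolding g_inf_ge_iff[OF assms] right_le_def
  using assms D_commute_P_iff[of "D k \<otimes> b" "- p"] by (simp add: D_simps algebra_simps)

lemma sup_right_le_iff:
  assumes "\<Delta> \<noteq> \<one>" "b \<in> carrier G" shows "D (- q) \<otimes> b \<lesssim> D k \<longleftrightarrow> g_sup b \<le> q + k"
  unfolding g_sup_le_iff[OF assms] right_le_def
  using assms D_commute_P_iff[of "inv b \<otimes> D q" "k"] by (simp add: D_simps algebra_simps)

text \<open>\<open>k = 0\<close> gives the bounds of the target interval, \<open>k = 1\<close> the
  bounds relaxed by one under which sliding is defined.\<close>

lemma bounds_right_le_D_iff:
  assumes "\<Delta> \<noteq> \<one>" "b \<in> tuples r"
  shows "(\<forall>(m, c) \<in> bounds r p q b. D m \<otimes> c \<lesssim> D k) \<longleftrightarrow>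
    (\<forall>j\<in>{1..r}. p j - k \<le> g_inf (b j) \<and> g_sup (b j) \<le> q j + k)"
  by (simp add: bounds_def ball_Un ball_conj_distrib tuples_carrier[OF assms(2)]
      inf_right_le_iff[OF assms(1)] sup_right_le_iff[OF assms(1)])

text \<open>The sliding element is the join of \<open>\<one>\<close> and all
  \<open>D m \<otimes> c\<close>, so later arguments can avoid normal forms. The element
  \<open>h\<close>, which conjugates \<open>b\<close> into the target, serves to exclude empty
  normal forms.\<close>

lemma
  assumes "\<Delta> \<noteq> \<one>" and b: "b \<in> tuples r"
    and relaxed: "\<forall>(m, c) \<in> bounds r p q b. D m \<otimes> c \<lesssim> \<Delta>"
    and h: "h \<in> carrier G" "\<forall>(m, c) \<in> bounds r p q b. D m \<otimes> h \<otimes> c \<lesssim> h"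
  shows slide_elt_in_P: "slide_elt r p q b \<in> P"
    and slide_elt_right_le_iff: "d \<in> P \<Longrightarrow>
      slide_elt r p q b \<lesssim> d \<longleftrightarrow> (\<forall>(m, c) \<in> bounds r p q b. D m \<otimes> c \<lesssim> d)"
proof -
  define X where "X = {tau_pow (- p j + 1) (compl_inv (first_factor (b j))) |j.
    j \<in> {1..r} \<and> p j = g_inf (b j) + 1}"
  define Y where "Y = {last_factor (b j) |j. j \<in> {1..r} \<and> q j = g_sup (b j) - 1}"
  have bj: "b j \<in> carrier G" if "j \<in> {1..r}" for j
    using b that by (rule tuples_carrier)
  have near: "p j - 1 \<le> g_inf (b j)" "g_sup (b j) \<le> q j + 1" if "j \<in> {1..r}" for j
    using relaxed bounds_right_le_D_iff[OF assms(1) b, of p q 1] that by (auto simp: D_1)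
  \<comment> \<open>An empty normal form would force \<open>b j = D (q j + 1)\<close>, and the
    condition on \<open>h\<close> would contradict \<open>conj_D_Suc_not_right_le\<close>.\<close>
  have nf: "normal_form (b j) \<noteq> []" if "j \<in> {1..r}" "q j = g_sup (b j) - 1" for j
  proof
    assume *: "normal_form (b j) = []"
    then have "g_sup (b j) = g_inf (b j)"
      using g_sup_eq[OF assms(1) bj[OF that(1)]] by simp
    moreover have "D (- g_inf (b j)) \<otimes> b j = \<one>"
      using normal_form(2)[OF assms(1) bj[OF that(1)]] * by simp
    then have "b j = D (g_inf (b j))"
      using bj[OF that(1)] by (metis D_closed inv_D inv_equality inv_inv)
    ultimately have "b j = D (q j + 1)"
      using that(2) by simp
    moreover have "D (- q j) \<otimes> h \<otimes> b j \<lesssim> h"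
      using h(2) that(1) by (auto simp: bounds_def)
    ultimately show False
      using conj_D_Suc_not_right_le assms(1) h(1) by metis
  qed
  have "finite X" "finite Y"
    unfolding X_def Y_def by auto
  moreover have "X \<subseteq> P"
    unfolding X_def using compl_inv_first_factor_in_P assms(1) bj by auto
  moreover have "Y \<subseteq> P"
    unfolding Y_def using normal_form_snoc[OF assms(1) bj nf] S_subset_P by fastforce
  ultimately have lcms: "left_lcm Gpos X \<in> P" "left_lcm Gpos Y \<in> P"
    and lcm_iff: "\<And>e. e \<in> P \<Longrightarrow> left_lcm Gpos X \<lesssim> e \<longleftrightarrow> (\<forall>x\<in>X. x \<lesssim> e)"
      "\<And>e. e \<in> P \<Longrightarrow> left_lcm Gpos Y \<lesssim> e \<longleftrightarrow> (\<forall>x\<in>Y. x \<lesssim> e)"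
    using Gpos.left_lcm_closed[of X] Gpos.left_lcm_closed[of Y]
      Gpos.left_lcm_right_divides_iff[of X] Gpos.left_lcm_right_divides_iff[of Y]
    by (auto simp: right_divides_Gpos_iff subset_iff)
  have elt: "slide_elt r p q b = left_lcm Gpos {left_lcm Gpos X, left_lcm Gpos Y}"
    by (simp add: slide_elt_def X_def Y_def)
  show x: "slide_elt r p q b \<in> P"
    unfolding elt using Gpos.left_lcm_closed[of "{left_lcm Gpos X, left_lcm Gpos Y}"] lcms by simp
  assume d: "d \<in> P"
  have "slide_elt r p q b \<lesssim> d \<longleftrightarrow> left_lcm Gpos X \<lesssim> d \<and> left_lcm Gpos Y \<lesssim> d"
    using Gpos.left_lcm_right_divides_iff[of "{left_lcm Gpos X, left_lcm Gpos Y}" d] lcms d x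
    by (simp add: right_divides_Gpos_iff elt)
  also have "\<dots> \<longleftrightarrow> (\<forall>x\<in>X. x \<lesssim> d) \<and> (\<forall>x\<in>Y. x \<lesssim> d)"
    using lcm_iff d by simp
  also have "(\<forall>x\<in>X. x \<lesssim> d) \<longleftrightarrow> (\<forall>j\<in>{1..r}. D (p j) \<otimes> inv (b j) \<lesssim> d)"
  proof -
    \<comment> \<open>An index omitted from the lcm already satisfies its bound, so its element lies
      below \<open>\<one>\<close>, hence below \<open>d\<close>.\<close>
    have "D (p j) \<otimes> inv (b j) \<lesssim> d" if "j \<in> {1..r}" "p j \<noteq> g_inf (b j) + 1" for j
      using inf_right_le_iff[OF assms(1) bj[OF that(1)], of "p j" 0] near[OF that(1)] that(2)
        right_le_trans[of _ \<one> d] d bj[OF that(1)] by (simp add: one_right_le_iff)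
    then show ?thesis
      unfolding X_def using first_factor_right_le_iff[OF assms(1) bj d] by blast
  qed
  also have "(\<forall>x\<in>Y. x \<lesssim> d) \<longleftrightarrow> (\<forall>j\<in>{1..r}. D (- q j) \<otimes> b j \<lesssim> d)"
  proof -
    have "D (- q j) \<otimes> b j \<lesssim> d" if "j \<in> {1..r}" "q j \<noteq> g_sup (b j) - 1" for j
      using sup_right_le_iff[OF assms(1) bj[OF that(1)], of "q j" 0] near[OF that(1)] that(2)
        right_le_trans[of _ \<one> d] d bj[OF that(1)] by (simp add: one_right_le_iff)
    then show ?thesis
      unfolding Y_def using last_factor_right_le_iff[OF assms(1) bj d nf] by blast
  qed
  finally show "slide_elt r p q b \<lesssim> d \<longleftrightarrow> (\<forall>(m, c) \<in> bounds r p q b. D m \<otimes> c \<lesssim> d)"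
    by (auto simp: bounds_def)
qed


section \<open>Iterated sliding\<close>

lemma right_le_iff_preimage:
  assumes "x \<in> carrier G" "z \<in> carrier G" "c \<in> carrier G"
  shows "D m \<otimes> x \<otimes> c \<lesssim> z \<longleftrightarrow> x \<lesssim> D (- m) \<otimes> z \<otimes> inv c"
  using right_le_D_mult_iff[of "x \<otimes> c" "D (- m) \<otimes> z" m]
    right_le_mult_right_iff[of x "D (- m) \<otimes> z \<otimes> inv c" c] assms
  by (simp add: D_simps)

lemma right_le_image_mono:
  assumes "x \<lesssim> z" "x \<in> carrier G" "z \<in> carrier G" "c \<in> carrier G"
  shows "D m \<otimes> x \<otimes> c \<lesssim> D m \<otimes> z \<otimes> c"
  using assms right_le_D_mult_iff[of "x \<otimes> c" "z \<otimes> c" m] right_le_mult_right_iff[of x z c]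
  by (simp add: m_assoc)

text \<open>Successive quotients \<open>w (Suc k) \<otimes> inv (w k)\<close> are nontrivial and
  positive, and their product telescopes. One more factor is added when \<open>w n\<close> differs
  from \<open>z\<close>.\<close>

lemma strict_chain_factors:
  assumes "\<And>k. w k \<in> carrier G"
    and "\<And>k. k < n \<Longrightarrow> w k \<lesssim> w (Suc k) \<and> w k \<noteq> w (Suc k)"
    and "w n \<lesssim> z" "z \<in> carrier G"
  shows "\<exists>xs. set xs \<subseteq> P - {\<one>} \<and> list_product G xs = z \<otimes> inv (w 0) \<and> n \<le> length xs"
proof -
  have ne: "z' \<otimes> inv x \<noteq> \<one>" if "x \<in> carrier G" "z' \<in> carrier G" "x \<noteq> z'" for x z'
    using that by (metis inv_closed inv_equality inv_inv)
  have "\<exists>xs. set xs \<subseteq> P - {\<one>} \<and> list_product G xs = w n \<otimes> inv (w 0) \<and> length xs = n"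
    using assms(2)
  proof (induction n)
    case 0
    then show ?case
      using assms(1) by (intro exI[of _ "[]"]) simp
  next
    case (Suc n)
    then obtain xs where xs: "set xs \<subseteq> P - {\<one>}" "list_product G xs = w n \<otimes> inv (w 0)" "length xs = n"
      by force
    have "w (Suc n) \<otimes> inv (w n) \<in> P - {\<one>}"
      using Suc.prems[of n] ne[OF assms(1) assms(1)] by (auto simp: right_le_def)
    then show ?case
      using xs assms(1) by (intro exI[of _ "w (Suc n) \<otimes> inv (w n) # xs"]) (simp add: m_assoc)
  qed
  then obtain xs where xs: "set xs \<subseteq> P - {\<one>}" "list_product G xs = w n \<otimes> inv (w 0)" "length xs = n"
    by blast
  show ?thesis
  proof (cases "w n = z")
    case False
    then show ?thesis
      using xs assms ne[OF assms(1,4)]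
      by (intro exI[of _ "z \<otimes> inv (w n) # xs"]) (simp add: m_assoc right_le_def)
  qed (use xs in auto)
qed

text \<open>Sliding enters only through \<open>mono\<close>, \<open>step\<close> and
  \<open>least\<close>: \<open>y (Suc k)\<close> is the join of \<open>y k\<close> and its images
  under the automorphisms given by \<open>K\<close>.\<close>

lemma join_iteration_stabilizes:
  assumes "\<Delta> \<noteq> \<one>"
    and K: "\<And>m c. (m, c) \<in> K \<Longrightarrow> c \<in> carrier G"
    and y: "\<And>k. y k \<in> carrier G" and y0: "y 0 = \<one>"
    and mono: "\<And>k. y k \<lesssim> y (Suc k)"
    and step: "\<And>m c k. (m, c) \<in> K \<Longrightarrow> D m \<otimes> y k \<otimes> c \<lesssim> y (Suc k)"
    and least: "\<And>k d. d \<in> carrier G \<Longrightarrow> y k \<lesssim> d \<Longrightarrow> (\<forall>(m, c) \<in> K. D m \<otimes> y k \<otimes> c \<lesssim> d) \<Longrightarrow>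
      y (Suc k) \<lesssim> d"
    and g: "g \<in> carrier G" "\<forall>(m, c) \<in> K. D m \<otimes> g \<otimes> c \<lesssim> g"
    and mc: "(m, c) \<in> K"
  defines "n \<equiv> atom_norm Gpos \<Delta> - 1"
  shows "D m \<otimes> y n \<otimes> c \<lesssim> y n"
proof -
  define stable where "stable h \<longleftrightarrow> h \<in> carrier G \<and> (\<forall>(m, c) \<in> K. D m \<otimes> h \<otimes> c \<lesssim> h)" for h
  have stable_D: "stable (D i \<otimes> h)" if "stable h" for i h
  proof -
    have "D m \<otimes> (D i \<otimes> h) \<otimes> c = D i \<otimes> (D m \<otimes> h \<otimes> c)" if "(m, c) \<in> K" for m c
      using K[OF that] \<open>stable h\<close> by (simp add: D_simps stable_def add.commute)
    then show ?thesis
      using that K by (auto simp: stable_def right_le_D_mult_iff)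
  qed
  have y_le_mono: "y j \<lesssim> y k" if "j \<le> k" for j k
    using that
  proof (induction rule: dec_induct)
    case (step k)
    then show ?case
      using mono right_le_trans y by blast
  qed (simp add: y)
  have y_le_stable: "y k \<lesssim> h" if h: "stable h" "\<one> \<lesssim> h" for k h
  proof (induction k)
    case (Suc k)
    have hG: "h \<in> carrier G"
      using h by (simp add: stable_def)
    \<comment> \<open>The image of \<open>y k\<close> lies below the image of \<open>h\<close>,
      which lies below \<open>h\<close> by stability.\<close>
    have "D m \<otimes> y k \<otimes> c \<lesssim> h" if "(m, c) \<in> K" for m c
      using right_le_trans[OF right_le_image_mono[OF Suc y hG K[OF that], of m]] that h K[OF that] y hG
      by (auto simp: stable_def)
    then show ?case
      using least[OF hG Suc] by auto
  qed (use h y0 in simp)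

  obtain i where "D i \<otimes> g \<in> P"
    using ex_D_mult_in_P g(1) by blast
  define h where "h = D i \<otimes> g"
  have h: "stable h" "\<one> \<lesssim> h" "h \<in> P"
    using stable_D[of g i] g \<open>D i \<otimes> g \<in> P\<close> by (auto simp: h_def stable_def one_right_le_iff)
  obtain N where N: "\<And>xs. set xs \<subseteq> P - {\<one>} \<Longrightarrow> list_product G xs = h \<Longrightarrow> length xs \<le> N"
    using Gpos.noetherian_bound[of h] h(3) by (auto simp: list_product_Gpos)
  \<comment> \<open>A sequence that never stalls would be a strict chain from \<open>\<one>\<close>
    below \<open>h\<close>, giving a factorization of \<open>h\<close> with more than
    \<open>N\<close> factors.\<close>
  obtain l where l: "y (Suc l) = y l"
  proof (rule ccontr)
    assume "\<not> thesis"
    then have "y k \<noteq> y (Suc k)" for k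
      using that by metis
    then obtain xs where "set xs \<subseteq> P - {\<one>}" "list_product G xs = h \<otimes> inv (y 0)" "Suc N \<le> length xs"
      using strict_chain_factors[of y "Suc N" h] y mono y_le_stable[OF h(1,2)] h(3) by auto
    then show False
      using N[of xs] h(3) y0 by simp
  qed
  define z where "z = y l"
  have z: "z \<in> carrier G" "stable z" "\<one> \<lesssim> z"
    using y step[of _ _ l] y_le_mono[of 0 l] y0 by (auto simp: z_def stable_def l)
  have y_le_z: "y k \<lesssim> z" for k
    using y_le_stable z by blast

  \<comment> \<open>The quotient of \<open>z\<close> by \<open>e\<close> is \<Delta>, so strict
    chains from \<open>e\<close> to \<open>z\<close> are factorizations of \<Delta>.\<close>
  define e where "e = D (- 1) \<otimes> z"
  have e: "e \<in> carrier G" "stable e" "e \<lesssim> z" "z \<otimes> inv e = \<Delta>"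
  proof -
    have "z = D 1 \<otimes> e"
      using z(1) by (simp add: e_def D_mult_left del: int_pow_1)
    then show "e \<lesssim> z"
      using right_le_mult_P[of e "D 1"] D_in_P[of 1] z(1) by (simp add: e_def)
    show "z \<otimes> inv e = \<Delta>"
      using z(1) unfolding e_def by (simp add: D_simps inv_mult_group inv_D)
  qed (use z stable_D in \<open>simp_all add: e_def\<close>)
  have not_e: "\<not> \<one> \<lesssim> e"
  proof
    \<comment> \<open>By minimality \<open>z\<close> would lie below \<open>e\<close>, making the
      inverse of \<Delta> positive.\<close>
    assume "\<one> \<lesssim> e"
    then have "z \<lesssim> e"
      using y_le_stable e(2) by (simp add: z_def)
    then have "D (- 1) \<in> P"
      using z(1) by (simp add: right_le_def e_def m_assoc)
    then show False
      using D_not_in_P assms(1) by force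
  qed
  obtain w where w: "\<And>k. w k \<in> carrier G" "\<And>k. y k \<lesssim> w k" "\<And>k. e \<lesssim> w k"
    "\<And>k d. d \<in> carrier G \<Longrightarrow> y k \<lesssim> d \<Longrightarrow> e \<lesssim> d \<Longrightarrow> w k \<lesssim> d"
  proof -
    have "\<exists>j. j \<in> carrier G \<and> y k \<lesssim> j \<and> e \<lesssim> j \<and>
      (\<forall>d. d \<in> carrier G \<longrightarrow> y k \<lesssim> d \<longrightarrow> e \<lesssim> d \<longrightarrow> j \<lesssim> d)" for k
      using ex_right_join[OF y[of k] e(1)] by metis
    then show thesis
      using that by metis
  qed
  have w_le_z: "w k \<lesssim> z" for k
    using w(4) z(1) y_le_z e(3) by blast
  have w_mono: "w k \<lesssim> w (Suc k)" for k
    using w(4)[of "w (Suc k)" k] w right_le_trans[OF mono w(2)] y by blast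
  have w_le_mono: "w j \<lesssim> w k" if "j \<le> k" for j k
    using that
  proof (induction rule: dec_induct)
    case (step k)
    then show ?case
      using w_mono right_le_trans w(1) by blast
  qed (simp add: w)
  have w_fix: "w k = z" if eq: "w k = w (Suc k)" for k
  proof -
    have "D m \<otimes> w k \<otimes> c \<lesssim> w (Suc k)" if mc: "(m, c) \<in> K" for m c
    proof -
      have c: "c \<in> carrier G"
        using K mc by blast
      have "D m \<otimes> y k \<otimes> c \<lesssim> w (Suc k)"
        using right_le_trans[OF step[OF mc] w(2)] y w(1) c by simp
      moreover have "D m \<otimes> e \<otimes> c \<lesssim> w (Suc k)"
        using right_le_trans[OF _ w(3), of "D m \<otimes> e \<otimes> c"] e(1,2) w(1) c mc
        by (auto simp: stable_def)
      \<comment> \<open>The preimage of \<open>w (Suc k)\<close> under the automorphism lies above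
        \<open>y k\<close> and \<open>e\<close>, hence above their join \<open>w k\<close>.\<close>
      ultimately have "w k \<lesssim> D (- m) \<otimes> w (Suc k) \<otimes> inv c"
        using w(1) c y e(1) by (intro w(4)) (simp_all add: right_le_iff_preimage)
      then show ?thesis
        using w(1) c by (simp add: right_le_iff_preimage)
    qed
    then have "stable (w k)"
      using w(1) eq by (auto simp: stable_def)
    moreover have "\<one> \<lesssim> w k"
      using right_le_trans[OF y_le_mono[of 0 k] w(2)] y0 y w(1) by simp
    ultimately have "z \<lesssim> w k"
      using y_le_stable by (simp add: z_def)
    then show ?thesis
      using right_le_antisym w_le_z w(1) z(1) by blast
  qed

  have "w n = z"
  proof (rule ccontr)
    assume "w n \<noteq> z"
    have strict: "w k \<noteq> w (Suc k)" if "k \<le> n" for k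
      using w_fix[of k] w_le_mono[OF that] w_le_z[of n] right_le_antisym[of "w n" z] w(1) z(1)
        \<open>w n \<noteq> z\<close> by auto
    \<comment> \<open>Prepending \<open>e\<close> to \<open>w 0\<close>, ...,
      \<open>w (n + 1)\<close> gives \<open>n + 2\<close> strict steps below \<open>z\<close>, so
      \<Delta> has at least \<open>n + 2\<close> nontrivial factors. This exceeds its norm.\<close>
    define v where "v k = (case k of 0 \<Rightarrow> e | Suc k \<Rightarrow> w k)" for k
    have "e \<noteq> w 0"
      using not_e w(2)[of 0] y0 by auto
    then have "v k \<lesssim> v (Suc k) \<and> v k \<noteq> v (Suc k)" if "k < n + 2" for k
      using that w(3) w_mono strict by (auto simp: v_def split: nat.split)
    moreover have "v k \<in> carrier G" "v (n + 2) \<lesssim> z" for k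
      using e w(1) w_le_z by (auto simp: v_def split: nat.split)
    ultimately obtain xs where "set xs \<subseteq> P - {\<one>}" "list_product G xs = \<Delta>" "n + 2 \<le> length xs"
      using strict_chain_factors[of v "n + 2" z] z(1) e(4) by (auto simp: v_def)
    then show False
      using Gpos.length_le_atom_norm[of xs \<Delta>] by (simp add: list_product_Gpos n_def)
  qed

  obtain N where N: "N \<ge> 0" "inv z \<otimes> D N \<in> P"
    using ex_D_right_multiple[of z] z by (auto simp: one_right_le_iff)
  \<comment> \<open>The exponent is lowered step by step: if
    \<open>e \<lesssim> D k \<otimes> y n\<close>, then the join \<open>w n = z\<close> of
    \<open>y n\<close> and \<open>e\<close> is also below \<open>D k \<otimes> y n\<close>. The
    start is a \<open>k\<close> so large that \<open>D (- k) \<otimes> z\<close> lies below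
    \<open>\<one>\<close>.\<close>
  have "z \<lesssim> y n" if "D (- int k) \<otimes> z \<lesssim> y n" for k
    using that
  proof (induction k)
    case (Suc k)
    have "D (int k) \<otimes> (D (- int (Suc k)) \<otimes> z) \<lesssim> D (int k) \<otimes> y n"
      using Suc.prems z(1) y by (simp add: right_le_D_mult_iff del: of_nat_Suc)
    then have "e \<lesssim> D (int k) \<otimes> y n"
      using z(1) by (simp add: D_simps e_def)
    then have "w n \<lesssim> D (int k) \<otimes> y n"
      using y right_le_mult_P D_in_P by (intro w(4)) simp_all
    then have "D (- int k) \<otimes> z \<lesssim> D (- int k) \<otimes> (D (int k) \<otimes> y n)"
      using y z(1) \<open>w n = z\<close> by (simp add: right_le_D_mult_iff)
    then show ?case
      using Suc.IH y by (simp add: D_simps)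
  qed (use z in simp)
  moreover have "D (- int (nat N)) \<otimes> z \<lesssim> \<one>"
    using N z(1) by (simp add: right_le_def D_simps)
  then have "D (- int (nat N)) \<otimes> z \<lesssim> y n"
    using right_le_trans[OF _ y_le_mono[of 0 n]] y0 y z(1) by simp
  ultimately have "z \<lesssim> y n" .
  then have "y n = z"
    using right_le_antisym y_le_z y z(1) by blast
  then show ?thesis
    using z(2) mc by (auto simp: stable_def)
qed

text \<open>This allows sliding to be iterated. The preimage \<open>d\<close> of
  \<open>D 1 \<otimes> x\<close> under \<open>u \<mapsto> D m \<otimes> u \<otimes> c\<close> lies
  above \<open>\<one>\<close> and above every \<open>D m' \<otimes> c'\<close>, because the latter
  are below \<Delta>. Hence it lies above their join \<open>x\<close>.\<close>

lemma conj_preserves_relaxed: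
  assumes K: "\<And>m c. (m, c) \<in> K \<Longrightarrow> c \<in> carrier G"
    and relaxed: "\<forall>(m, c) \<in> K. D m \<otimes> c \<lesssim> \<Delta>"
    and x: "x \<in> P" "\<And>d. d \<in> P \<Longrightarrow> x \<lesssim> d \<longleftrightarrow> (\<forall>(m, c) \<in> K. D m \<otimes> c \<lesssim> d)"
    and mc: "(m, c) \<in> K"
  shows "D m \<otimes> (x \<otimes> c \<otimes> inv x) \<lesssim> \<Delta>"
proof -
  have c: "c \<in> carrier G"
    using K mc by blast
  have le_x: "D m \<otimes> c \<lesssim> x"
    using x(2)[OF x(1)] x(1) mc by auto
  have xx: "x \<lesssim> D 1 \<otimes> x"
    using right_le_mult_P[of x "D 1"] D_in_P[of 1] x(1) by simp
  define d where "d = D (- m) \<otimes> (D 1 \<otimes> x) \<otimes> inv c"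
  have le_d: "u \<lesssim> d \<longleftrightarrow> D m \<otimes> u \<otimes> c \<lesssim> D 1 \<otimes> x" if "u \<in> carrier G" for u
    unfolding d_def using right_le_iff_preimage[OF that, of "D 1 \<otimes> x" c m] c x(1) by simp
  have "\<one> \<lesssim> d"
    using le_d[of \<one>] right_le_trans[OF le_x xx] c x(1) by simp
  moreover have "D m' \<otimes> c' \<lesssim> d" if "(m', c') \<in> K" for m' c'
  proof -
    have c': "c' \<in> carrier G"
      using K that by blast
    have "D m' \<otimes> c' \<lesssim> D 1"
      using relaxed that by (auto simp: D_1)
    then have "D m \<otimes> (D m' \<otimes> c') \<otimes> c \<lesssim> D m \<otimes> D 1 \<otimes> c"
      using right_le_image_mono c c' by simp
    also have "D m \<otimes> D 1 \<otimes> c = D 1 \<otimes> (D m \<otimes> c)"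
      using c by (simp add: D_simps add.commute del: int_pow_1)
    also have "\<dots> \<lesssim> D 1 \<otimes> x"
      using le_x c x(1) right_le_D_mult_iff[of "D m \<otimes> c" x 1] by simp
    finally show ?thesis
      using le_d c c' x(1) by simp
  qed
  ultimately have "x \<lesssim> d"
    using x one_right_le_iff[of d] c by (auto simp: d_def)
  then have "D m \<otimes> x \<otimes> c \<lesssim> D 1 \<otimes> x"
    using le_d x(1) by simp
  then show ?thesis
    using right_le_mult_right_iff[of "D m \<otimes> x \<otimes> c" "D 1 \<otimes> x" "inv x"] c x(1)
    by (simp add: m_assoc)
qed

section \<open>Conjugated tuples and the passage from joins to sliding\<close>

definition translate :: "nat \<Rightarrow> 'a \<Rightarrow> (nat \<Rightarrow> 'a) \<Rightarrow> nat \<Rightarrow> 'a" where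
  "translate r g b = (\<lambda>j\<in>{1..r}. g \<otimes> b j \<otimes> inv g)"

lemma translate_tuples: "g \<in> carrier G \<Longrightarrow> b \<in> tuples r \<Longrightarrow> translate r g b \<in> tuples r"
  by (auto simp: translate_def tuples_def)

lemma translate_one: "b \<in> tuples r \<Longrightarrow> translate r \<one> b = b"
  by (auto simp: translate_def tuples_def fun_eq_iff PiE_iff extensional_def)

lemma translate_mult:
  "g \<in> carrier G \<Longrightarrow> h \<in> carrier G \<Longrightarrow> b \<in> tuples r \<Longrightarrow>
    translate r (g \<otimes> h) b = translate r g (translate r h b)"
  by (auto simp: translate_def tuples_carrier m_assoc inv_mult_group)

lemma bounds_translate:
  assumes "g \<in> carrier G" "b \<in> tuples r"
  shows "bounds r p q (translate r g b) = (\<lambda>(m, c). (m, g \<otimes> c \<otimes> inv g)) ` bounds r p q b"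
  using assms tuples_carrier[OF assms(2)]
  by (auto simp: bounds_def translate_def image_Un image_image m_assoc inv_mult_group)

lemma slide_power_mem_interval:
  assumes "\<Delta> \<noteq> \<one>" and a: "a \<in> tuples r" and pq: "\<forall>j\<in>{1..r}. p j \<le> q j"
    and relaxed: "\<forall>j\<in>{1..r}. p j - 1 \<le> g_inf (a j) \<and> g_sup (a j) \<le> q j + 1"
    and g: "g \<in> carrier G" "translate r g a \<in> interval r p q"
  shows "(slide r p q ^^ (atom_norm Gpos \<Delta> - 1)) a \<in> interval r p q"
proof -
  define K where "K = bounds r p q a"
  have K: "c \<in> carrier G" if "(m, c) \<in> K" for m c
    using that bounds_carrier a by (simp add: K_def)
  have bounds: "(\<forall>(m, c) \<in> bounds r p q (translate r h a). Q m c) \<longleftrightarrow>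
      (\<forall>(m, c) \<in> K. Q m (h \<otimes> c \<otimes> inv h))" if "h \<in> carrier G" for Q h
    using bounds_translate[OF that a] by (auto simp: K_def)
  \<comment> \<open>Right multiplication by \<open>h\<close> turns the bounds on the conjugated
    tuple into stability of \<open>h\<close>.\<close>
  have interval_iff: "translate r h a \<in> interval r p q \<longleftrightarrow> (\<forall>(m, c) \<in> K. D m \<otimes> h \<otimes> c \<lesssim> h)"
    if h: "h \<in> carrier G" for h
  proof -
    have "translate r h a \<in> interval r p q \<longleftrightarrow>
      (\<forall>(m, c) \<in> K. D m \<otimes> (h \<otimes> c \<otimes> inv h) \<lesssim> D 0)"
      using bounds_right_le_D_iff[OF assms(1) translate_tuples[OF h a], of p q 0] pq
        translate_tuples[OF h a] bounds[OF h, of "\<lambda>m c. D m \<otimes> c \<lesssim> D 0"]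
      by (auto simp: interval_def)
    also have "\<dots> \<longleftrightarrow> (\<forall>(m, c) \<in> K. D m \<otimes> h \<otimes> c \<lesssim> h)"
    proof -
      have "D m \<otimes> (h \<otimes> c \<otimes> inv h) \<lesssim> D 0 \<longleftrightarrow> D m \<otimes> h \<otimes> c \<lesssim> h" if "(m, c) \<in> K" for m c
        using right_le_mult_right_iff[of "D m \<otimes> (h \<otimes> c \<otimes> inv h)" "\<one>" h] K[OF that] h
        by (simp add: m_assoc)
      then show ?thesis by auto
    qed
    finally show ?thesis .
  qed
  have g_stable: "\<forall>(m, c) \<in> K. D m \<otimes> g \<otimes> c \<lesssim> g"
    using interval_iff g by blast

  define x where "x h = slide_elt r p q (translate r h a)" for h
  \<comment> \<open>The accumulated conjugator: each new sliding element is multiplied on the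
    left.\<close>
  define y where "y k = rec_nat \<one> (\<lambda>_ h. x h \<otimes> h) k" for k
  have y_simps: "y 0 = \<one>" "\<And>k. y (Suc k) = x (y k) \<otimes> y k"
    by (simp_all add: y_def)
  define relaxed_at where "relaxed_at h \<longleftrightarrow> (\<forall>(m, c) \<in> K. D m \<otimes> (h \<otimes> c \<otimes> inv h) \<lesssim> \<Delta>)" for h
  have x: "x h \<in> P" "d \<in> P \<Longrightarrow> x h \<lesssim> d \<longleftrightarrow> (\<forall>(m, c) \<in> K. D m \<otimes> (h \<otimes> c \<otimes> inv h) \<lesssim> d)"
    if h: "h \<in> carrier G" and "relaxed_at h" for h d
  proof -
    \<comment> \<open>\<open>g \<otimes> inv h\<close> carries the tuple conjugated by
      \<open>h\<close> into the target interval, and so is the witness required for the sliding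
      element of that tuple.\<close>
    have "D m \<otimes> (g \<otimes> inv h) \<otimes> (h \<otimes> c \<otimes> inv h) \<lesssim> g \<otimes> inv h" if "(m, c) \<in> K" for m c
      using g_stable that K[OF that] right_le_mult_right_iff[of "D m \<otimes> g \<otimes> c" g "inv h"] g(1) h
      by (auto simp: m_assoc)
    then have reach: "\<forall>(m, c) \<in> bounds r p q (translate r h a). D m \<otimes> (g \<otimes> inv h) \<otimes> c \<lesssim> g \<otimes> inv h"
      using bounds[OF h, of "\<lambda>m c. D m \<otimes> (g \<otimes> inv h) \<otimes> c \<lesssim> g \<otimes> inv h"] by blast
    have near: "\<forall>(m, c) \<in> bounds r p q (translate r h a). D m \<otimes> c \<lesssim> \<Delta>"
      using \<open>relaxed_at h\<close> bounds[OF h, of "\<lambda>m c. D m \<otimes> c \<lesssim> \<Delta>"] by (simp add: relaxed_at_def)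
    note * = assms(1) translate_tuples[OF h a] near _ reach
    show "x h \<in> P" "d \<in> P \<Longrightarrow> x h \<lesssim> d \<longleftrightarrow> (\<forall>(m, c) \<in> K. D m \<otimes> (h \<otimes> c \<otimes> inv h) \<lesssim> d)"
      using slide_elt_in_P[OF *] slide_elt_right_le_iff[OF *] g(1) h
        bounds[OF h, of "\<lambda>m c. D m \<otimes> c \<lesssim> d"]
      by (simp_all add: x_def)
  qed
  have inv: "y k \<in> carrier G \<and> relaxed_at (y k) \<and> (slide r p q ^^ k) a = translate r (y k) a" for k
  proof (induction k)
    case 0
    have "\<forall>(m, c) \<in> K. D m \<otimes> c \<lesssim> D 1"
      using bounds_right_le_D_iff[OF assms(1) a, of p q 1] relaxed by (simp add: K_def)
    then show ?case
      using K a by (auto simp: y_simps relaxed_at_def translate_one D_1)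
  next
    case (Suc k)
    then have yk: "y k \<in> carrier G" "relaxed_at (y k)"
      and IH: "(slide r p q ^^ k) a = translate r (y k) a"
      by auto
    note xk = x[OF yk]
    have "(slide r p q ^^ Suc k) a = translate r (y (Suc k)) a"
      using IH xk(1) yk(1) a by (simp add: y_simps translate_mult slide_def x_def) (simp add: translate_def)
    moreover have "relaxed_at (y (Suc k))"
    proof -
      \<comment> \<open>These are the bounds of the current tuple, expressed through those of
        \<open>a\<close>.\<close>
      define K' where "K' = (\<lambda>(m, c). (m, y k \<otimes> c \<otimes> inv (y k))) ` K"
      have "D m \<otimes> (x (y k) \<otimes> (y k \<otimes> c \<otimes> inv (y k)) \<otimes> inv (x (y k))) \<lesssim> \<Delta>" if "(m, c) \<in> K" for m c
      proof (rule conj_preserves_relaxed[of K'])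
        show "\<forall>(m, c) \<in> K'. D m \<otimes> c \<lesssim> \<Delta>"
          using yk(2) by (auto simp: relaxed_at_def K'_def)
        show "x (y k) \<lesssim> d \<longleftrightarrow> (\<forall>(m, c) \<in> K'. D m \<otimes> c \<lesssim> d)" if "d \<in> P" for d
          using xk(2)[OF that] by (auto simp: K'_def)
      qed (use K yk(1) xk(1) that in \<open>auto simp: K'_def\<close>)
      then show ?thesis
        using K yk(1) xk(1) by (auto simp: relaxed_at_def y_simps m_assoc inv_mult_group)
    qed
    ultimately show ?case
      using yk(1) xk(1) by (simp add: y_simps)
  qed
  then have y: "y k \<in> carrier G" and rel: "relaxed_at (y k)" for k
    by auto
  have xP: "x (y k) \<in> P" for k
    using x(1) y rel by blast
  define n where "n = atom_norm Gpos \<Delta> - 1"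
  have "D m \<otimes> y n \<otimes> c \<lesssim> y n" if "(m, c) \<in> K" for m c
    unfolding n_def
  proof (rule join_iteration_stabilizes[where K = K and y = y and g = g])
    show "y k \<lesssim> y (Suc k)" for k
      using y xP right_le_mult_P by (simp add: y_simps)
    \<comment> \<open>Right multiplication by \<open>inv (y k)\<close> passes from conjugators of
      \<open>a\<close> to conjugators of the current tuple.\<close>
    have shift: "D m \<otimes> y k \<otimes> c \<lesssim> d \<longleftrightarrow> D m \<otimes> (y k \<otimes> c \<otimes> inv (y k)) \<lesssim> d \<otimes> inv (y k)"
      if "(m, c) \<in> K" "d \<in> carrier G" for m c k d
      using right_le_mult_right_iff[of "D m \<otimes> y k \<otimes> c" d "inv (y k)"] K[OF that(1)] y that(2)
      by (simp add: m_assoc)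
    show "D m \<otimes> y k \<otimes> c \<lesssim> y (Suc k)" if "(m, c) \<in> K" for m c k
      using shift[OF that, of "y (Suc k)" k] x(2)[OF y rel xP, of k k] y[of k] xP[of k] that
      by (auto simp: y_simps m_assoc)
    fix k d assume d: "d \<in> carrier G" "y k \<lesssim> d" "\<forall>(m, c) \<in> K. D m \<otimes> y k \<otimes> c \<lesssim> d"
    \<comment> \<open>\<open>y k \<lesssim> d\<close> says that \<open>d \<otimes> inv (y k)\<close>
      is positive, so the join property of the sliding element applies to it.\<close>
    then have "x (y k) \<lesssim> d \<otimes> inv (y k)"
      using shift x(2)[OF y rel, of "d \<otimes> inv (y k)" k] by (auto simp: right_le_def)
    then show "y (Suc k) \<lesssim> d"
      using right_le_mult_right_iff[of "x (y k)" "d \<otimes> inv (y k)" "y k"] d(1) y[of k] xP[of k]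
      by (simp add: y_simps m_assoc)
  qed (use assms(1) K y y_simps g(1) g_stable that in auto)
  then have "translate r (y n) a \<in> interval r p q"
    using interval_iff y by auto
  then show ?thesis
    using inv[of n] by (simp add: n_def)
qed

text \<open>\<open>conj_tuple\<close> and sliding conjugate in opposite directions, hence the
  inverse.\<close>

lemma conj_tuple_eq_translate:
  "g \<in> carrier G \<Longrightarrow> conj_tuple r a g = translate r (inv g) a"
  by (simp add: conj_tuple_def translate_def)

end

theorem theorem5p4:
  fixes G :: "('a, 'b) monoid_scheme" and S :: "'a set" and \<Delta> :: 'a
    and r i :: nat and p q p' q' :: "nat \<Rightarrow> int" and a :: "nat \<Rightarrow> 'a"
  assumes "garside_group G S \<Delta>"
    and "\<forall>j\<in>{1..r}. p j \<le> q j"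
    and "a \<in> garside_group.interval G S \<Delta> r p q"
    and "i \<in> {1..r}"
    and "(p', q') \<in> {(\<lambda>j. p j + unit_tuple i j, q), (p, \<lambda>j. q j - unit_tuple i j)}"
    and "garside_group.conj_class G r a \<inter> garside_group.interval G S \<Delta> r p' q' \<noteq> {}"
  shows "(garside_group.slide G S \<Delta> r p' q' ^^ (atom_norm (positive_monoid G S) \<Delta> - 1)) a
    \<in> garside_group.interval G S \<Delta> r p' q'"
proof -
  interpret garside_group G S \<Delta>
    by (rule assms(1))
  obtain g where g: "g \<in> carrier G" "conj_tuple r a g \<in> interval r p' q'"
    using assms(6) by (auto simp: conj_class_def)
  have a: "a \<in> tuples r"
    using assms(3) by (simp add: interval_def)
  show ?thesis
  proof (cases "\<Delta> = \<one>\<^bsub>G\<^esub>")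
    case True
    \<comment> \<open>The group is trivial, and \<open>g_inf\<close>, \<open>g_sup\<close> are unspecified.\<close>
    have "conj_tuple r a g = a"
      using Delta_one_imp_trivial[OF True] g(1) translate_one[OF a]
      by (metis conj_tuple_eq_translate inv_closed)
    then show ?thesis
      using g(2) atom_norm_trivial[OF True] by simp
  next
    case False
    \<comment> \<open>For either choice of the pair, one coordinate of one bound is tightened by
      one, so \<open>a\<close> satisfies the relaxed bounds.\<close>
    have "p' j - 1 \<le> p j \<and> q j \<le> q' j + 1" for j
      using assms(5) by (auto simp: unit_tuple_def)
    then have "\<forall>j\<in>{1..r}. p' j - 1 \<le> g_inf (a j) \<and> g_sup (a j) \<le> q' j + 1"
      using assms(3) unfolding interval_def by (smt (verit) mem_Collect_eq)
    moreover have "\<forall>j\<in>{1..r}. p' j \<le> q' j"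
      using g(2) by (simp add: interval_def)
    ultimately show ?thesis
      using slide_power_mem_interval[OF False a, of p' q' "inv\<^bsub>G\<^esub> g"] g conj_tuple_eq_translate
      by simp
  qed
qed

end
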